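(* Let $G$ be a tree on the vertex set $[n]=\{1,\dots,n\}$. Let $\{e_{\{i,j\}} : \{i,j\}\in E(G)\}$ be the standard basis of $S^{n-1}$. Then the first syzygy of $L_G$ is minimally generated by the elements of the form (a) $g_{i,j}e_{\{k,l\}}-g_{k,l}e_{\{i,j\}}$, where $\{i,j\}\neq\{k,l\}\in E(G)$ (one for each unordered pair of distinct edges), and (b) $f_{k,l}e_{\{i,j\}}-f_{j,l}e_{\{i,k\}}+f_{j,k}e_{\{i,l\}}$, where $\{i,j,k,l\}$ is an induced claw of $G$ with center $i$ and leaves $j<k<l$ (one for each such claw).
   Context: Let $\mathbb{K}$ be any field and $S=\mathbb{K}[x_1,\dots,x_n,y_1,\dots,y_n]$. Put $g_{i,j}=x_ix_j+y_iy_j$ and $f_{i,j}=x_iy_j-x_jy_i$. For a finite simple graph $G$ on $[n]$, the Lovász-Saks-Schrijver (LSS) ideal is $L_G=(g_{i,j} : \{i,j\}\in E(G))\subset S$. The first syzygy of $L_G$ is the kernel of the $S$-linear map from the free module with basis $\{e_{\{i,j\}}:\{i,j\}\in E(G)\}$ to $L_G$ sending $e_{\{i,j\}}$ to $g_{i,j}$. A claw with center $i$ and leaves $j,k,l$ is the graph with vertices $i,j,k,l$ and edges $\{i,j\},\{i,k\},\{i,l\}$. *)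

theory Defs
  imports Complex_Main "HOL-Library.Poly_Mapping"
begin

text \<open>
  The vertex set \<open>[n]\<close> is rendered by an arbitrary nonempty finite linearly ordered type \<open>'n\<close>
  (so \<open>n = CARD('n)\<close>, and the order of \<open>'n\<close> is the order of \<open>[n]\<close>).
  The ring \<open>S\<close> is then the type of finitely supported maps from monomials (exponent vectors
  in the \<open>2n\<close> variables) to the coefficient field, with the convolution product of
  \<^theory>\<open>HOL-Library.Poly_Mapping\<close>.
\<close>

subsection \<open>Finite simple graphs and trees\<close>

definition simple_graph :: "'n set set \<Rightarrow> bool" where
  "simple_graph E \<longleftrightarrow> (\<forall>e\<in>E. card e = 2)"

definition connected_graph :: "'n set set \<Rightarrow> bool" where
  "connected_graph E \<longleftrightarrow> (\<forall>u v. (u, v) \<in> {(a, b). {a, b} \<in> E}\<^sup>*)"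

definition graph_cycle :: "'n set set \<Rightarrow> 'n list \<Rightarrow> bool" where
  "graph_cycle E vs \<longleftrightarrow>
     3 \<le> length vs \<and> distinct vs \<and> successively (\<lambda>a b. {a, b} \<in> E) vs \<and> {last vs, hd vs} \<in> E"

definition tree :: "'n set set \<Rightarrow> bool" where
  "tree E \<longleftrightarrow> simple_graph E \<and> connected_graph E \<and> (\<nexists>vs. graph_cycle E vs)"

text \<open>The claws that are induced subgraphs, each listed once, as (center, leaves in increasing order).\<close>

definition induced_claws :: "'n::linorder set set \<Rightarrow> ('n \<times> 'n \<times> 'n \<times> 'n) set" where
  "induced_claws E = {(i, j, k, l). j < k \<and> k < l \<and> i \<notin> {j, k, l} \<and>
     {e \<in> E. e \<subseteq> {i, j, k, l}} = {{i, j}, {i, k}, {i, l}}}"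


subsection \<open>The polynomial ring\<close>

datatype 'n var = XVar 'n | YVar 'n

type_synonym ('n, 'k) S = "('n var \<Rightarrow>\<^sub>0 nat) \<Rightarrow>\<^sub>0 'k"

definition Var :: "'n var \<Rightarrow> ('n, 'k::field) S" where
  "Var v = Poly_Mapping.single (Poly_Mapping.single v 1) 1"

abbreviation var_x :: "'n \<Rightarrow> ('n, 'k::field) S" where "var_x i \<equiv> Var (XVar i)"
abbreviation var_y :: "'n \<Rightarrow> ('n, 'k::field) S" where "var_y i \<equiv> Var (YVar i)"

definition g_poly :: "'n \<Rightarrow> 'n \<Rightarrow> ('n, 'k::field) S" where
  "g_poly i j = var_x i * var_x j + var_y i * var_y j"

definition f_poly :: "'n \<Rightarrow> 'n \<Rightarrow> ('n, 'k::field) S" where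
  "f_poly i j = var_x i * var_y j - var_x j * var_y i"

text \<open>The polynomial \<open>g_poly i j\<close> of an edge \<open>{i, j}\<close>; well defined since \<open>g_poly\<close> is symmetric.\<close>

definition g_edge :: "'n::linorder set \<Rightarrow> ('n, 'k::field) S" where
  "g_edge e = g_poly (Min e) (Max e)"

lemma g_edge_doubleton [simp]: "g_edge {i, j} = g_poly i j"
  by (cases "i \<le> j") (auto simp: g_edge_def g_poly_def min_def max_def mult.commute)


subsection \<open>Free modules\<close>

text \<open>
  The finitely supported maps \<open>'b \<Rightarrow>\<^sub>0 'r\<close> form the free \<open>'r\<close>-module on \<open>'b\<close>,
  with basis elements \<open>basis_vec b\<close>.
\<close>

definition scale :: "'r::comm_ring_1 \<Rightarrow> ('b \<Rightarrow>\<^sub>0 'r) \<Rightarrow> ('b \<Rightarrow>\<^sub>0 'r)" where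
  "scale c v = Poly_Mapping.map ((*) c) v"

definition basis_vec :: "'b \<Rightarrow> ('b \<Rightarrow>\<^sub>0 'r::comm_ring_1)" where
  "basis_vec b = Poly_Mapping.single b 1"

lemma lookup_scale [simp]: "Poly_Mapping.lookup (scale c v) b = c * Poly_Mapping.lookup v b"
  by (simp add: scale_def Poly_Mapping.map.rep_eq when_def)

interpretation free_module: module scale
  by standard (auto intro!: poly_mapping_eqI simp: lookup_add algebra_simps)

lemma module_mult_self: "module ((*) :: 'r::comm_ring_1 \<Rightarrow> 'r \<Rightarrow> 'r)"
  by standard (simp_all add: algebra_simps)

definition free_on :: "'b set \<Rightarrow> ('b \<Rightarrow>\<^sub>0 'r::comm_ring_1) set" where
  "free_on B = {v. Poly_Mapping.keys v \<subseteq> B}"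

lemma free_on_eq_span: "free_on B = free_module.span (basis_vec ` B)"
proof (intro equalityI subsetI)
  fix v :: "'a \<Rightarrow>\<^sub>0 'b" assume v: "v \<in> free_on B"
  have "v = (\<Sum>b\<in>Poly_Mapping.keys v. scale (Poly_Mapping.lookup v b) (basis_vec b))"
    by (rule poly_mapping_eqI)
      (auto simp: lookup_sum basis_vec_def lookup_single when_def in_keys_iff if_distrib cong: if_cong)
  also have "\<dots> \<in> free_module.span (basis_vec ` B)"
    using v by (intro free_module.span_sum free_module.span_scale free_module.span_base)
      (auto simp: free_on_def)
  finally show "v \<in> free_module.span (basis_vec ` B)" .
next
  fix v :: "'a \<Rightarrow>\<^sub>0 'b" assume "v \<in> free_module.span (basis_vec ` B)"
  then show "v \<in> free_on B"
  proof (induction rule: free_module.span_induct_alt)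
    case base
    then show ?case by (simp add: free_on_def)
  next
    case (step c x y)
    then have "Poly_Mapping.lookup (scale c x + y) b = 0" if "b \<notin> B" for b
      using that by (auto simp: free_on_def basis_vec_def lookup_add lookup_single when_def in_keys_iff)
    then show ?case by (auto simp: free_on_def in_keys_iff)
  qed
qed

text \<open>The family \<open>v\<close> on \<open>I\<close> generates the submodule \<open>M\<close>, and no proper subfamily does.
  In particular \<open>v\<close> is then injective on \<open>I\<close>.\<close>

definition minimally_generates ::
    "'i set \<Rightarrow> ('i \<Rightarrow> ('b \<Rightarrow>\<^sub>0 'r::comm_ring_1)) \<Rightarrow> ('b \<Rightarrow>\<^sub>0 'r) set \<Rightarrow> bool" where
  "minimally_generates I v M \<longleftrightarrow>
     free_module.span (v ` I) = M \<and> (\<forall>J. J \<subset> I \<longrightarrow> free_module.span (v ` J) \<noteq> M)"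


subsection \<open>The LSS ideal and its first syzygy\<close>

definition LSS_ideal :: "'n::linorder set set \<Rightarrow> ('n, 'k::field) S set" where
  "LSS_ideal E = module.span (*) (g_edge ` E)"

definition LSS_map :: "'n::linorder set set \<Rightarrow> ('n set \<Rightarrow>\<^sub>0 ('n, 'k::field) S) \<Rightarrow> ('n, 'k) S" where
  "LSS_map E v = (\<Sum>e\<in>E. Poly_Mapping.lookup v e * g_edge e)"

definition first_syzygy :: "'n::linorder set set \<Rightarrow> ('n set \<Rightarrow>\<^sub>0 ('n, 'k::field) S) set" where
  "first_syzygy E = {v \<in> free_on E. LSS_map E v = 0}"

lemma LSS_map_basis_vec:
  assumes "finite E" "e \<in> E"
  shows "LSS_map E (basis_vec e) = g_edge e"
  using assms by (simp add: LSS_map_def basis_vec_def lookup_single when_def if_distrib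
      if_distribR sum.delta' cong: if_cong)

lemma LSS_map_image:
  assumes "finite E"
  shows "LSS_map E ` free_on E = (LSS_ideal E :: ('n::linorder, 'k::field) S set)"
proof (intro equalityI subsetI)
  note span_sum = module.span_sum[OF module_mult_self]
    and span_scale = module.span_scale[OF module_mult_self]
    and span_base = module.span_base[OF module_mult_self]
  fix p :: "('n, 'k) S" assume "p \<in> LSS_map E ` free_on E"
  then show "p \<in> LSS_ideal E"
    unfolding LSS_map_def LSS_ideal_def by (auto intro!: span_sum span_scale intro: span_base)
next
  fix p :: "('n, 'k) S" assume "p \<in> LSS_ideal E"
  then have "p \<in> module.span (*) (g_edge ` E)" by (simp add: LSS_ideal_def)
  then show "p \<in> LSS_map E ` free_on E"
  proof (induction rule: module.span_induct_alt[OF module_mult_self, consumes 1, case_names base step])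
    case base
    have "LSS_map E 0 = (0 :: ('n, 'k) S)" "0 \<in> free_on E"
      by (simp_all add: LSS_map_def free_on_def)
    then show ?case by force
  next
    case (step c q r)
    then obtain e v where e: "e \<in> E" "q = g_edge e" and v: "v \<in> free_on E" "r = LSS_map E v"
      by auto
    let ?w = "scale c (basis_vec e) + v"
    have "?w \<in> free_on E"
      using e v unfolding free_on_eq_span
      by (auto intro!: free_module.span_add free_module.span_scale intro: free_module.span_base)
    moreover have "LSS_map E ?w = c * LSS_map E (basis_vec e) + LSS_map E v"
      by (simp add: LSS_map_def lookup_add algebra_simps sum.distrib sum_distrib_left)
    ultimately show ?case using LSS_map_basis_vec[OF assms e(1)] e v by (metis imageI)
  qed
qed


subsection \<open>The two kinds of syzygies\<close>

definition koszul_syz :: "'n::linorder set \<times> 'n set \<Rightarrow> ('n set \<Rightarrow>\<^sub>0 ('n, 'k::field) S)" where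
  "koszul_syz = (\<lambda>(d, e). scale (g_edge d) (basis_vec e) - scale (g_edge e) (basis_vec d))"

definition claw_syz :: "'n \<times> 'n \<times> 'n \<times> 'n \<Rightarrow> ('n set \<Rightarrow>\<^sub>0 ('n, 'k::field) S)" where
  "claw_syz = (\<lambda>(i, j, k, l). scale (f_poly k l) (basis_vec {i, j}) - scale (f_poly j l) (basis_vec {i, k})
     + scale (f_poly j k) (basis_vec {i, l}))"

text \<open>
  Exchanging the two edges changes the sign of \<open>koszul_syz\<close>, so one element for each unordered pair
  means: one for each member of a set \<open>P\<close> that contains exactly one of \<open>(d, e)\<close>, \<open>(e, d)\<close>
  for any two distinct edges.
\<close>

definition one_order_per_pair :: "'a set \<Rightarrow> ('a \<times> 'a) set \<Rightarrow> bool" where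
  "one_order_per_pair E P \<longleftrightarrow> P \<subseteq> E \<times> E \<and> irrefl P \<and>
     (\<forall>d\<in>E. \<forall>e\<in>E. d \<noteq> e \<longrightarrow> ((d, e) \<in> P \<longleftrightarrow> (e, d) \<notin> P))"

end

theory Submission
  imports Defs
begin

text \<open>
  A tree is bipartite; rotating the columns \<open>(x\<^sub>i, y\<^sub>i)\<close> on one colour class turns \<open>L\<^sub>G\<close> into a binomial
  edge ideal over any field. Adding the edges of the tree one at a time, a syzygy on \<open>F \<union> {{u, v}}\<close>
  has its coefficient at \<open>{u, v}\<close> in the colon ideal \<open>L\<^sub>F : g\<^sub>u\<^sub>v\<close>. This colon ideal is contained in the ideal
  \<open>J\<close> generated by \<open>L\<^sub>F\<close> and all \<open>f\<^sub>a\<^sub>b\<close> with \<open>a\<close>, \<open>b\<close> both neighbours of \<open>u\<close> or both neighbours of \<open>v\<close>, because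
  \<open>g\<^sub>u\<^sub>v\<close> is regular modulo \<open>J\<close>; and each generator of \<open>J\<close> is the last coefficient of a Koszul or a claw
  syzygy. Regularity holds because \<open>u\<close> and \<open>v\<close> are simplicial vertices of different components of the graph
  of \<open>J\<close>: Ohtani's lemma writes \<open>J\<close> as an intersection of ideals of graphs with fewer non-simplicial
  vertices, until all components are cliques and the ideal is the kernel of a monomial substitution.

  Minimality: every generator has a component with a quadratic monomial none of whose divisors occurs in
  the same component of another generator.
\<close>

section \<open>Weighted maps of monoid algebras\<close>

lemma poly_mapping_single_induct [case_names zero single add]:
  assumes "P 0"
    and "\<And>m c. P (Poly_Mapping.single m c)"
    and "\<And>p q. P p \<Longrightarrow> P q \<Longrightarrow> P (p + q)"
  shows "P (p :: 'a \<Rightarrow>\<^sub>0 'b::monoid_add)"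
proof (induction p rule: update_induct)
  case const
  then show ?case using assms(1) .
next
  case (update f a b)
  have "Poly_Mapping.update a b f = f + Poly_Mapping.single a b"
    using update by (intro poly_mapping_eqI) (auto simp: lookup_update lookup_add lookup_single when_def in_keys_iff)
  then show ?case using assms(2,3) update by metis
qed

definition linear_ext :: "('a \<Rightarrow> 'k::zero \<Rightarrow> 'c::comm_monoid_add) \<Rightarrow> ('a \<Rightarrow>\<^sub>0 'k) \<Rightarrow> 'c" where
  "linear_ext f p = (\<Sum>m\<in>Poly_Mapping.keys p. f m (Poly_Mapping.lookup p m))"

lemma linear_ext_zero [simp]: "linear_ext f 0 = 0"
  by (simp add: linear_ext_def)

lemma linear_ext_single:
  assumes "f m 0 = 0"
  shows "linear_ext f (Poly_Mapping.single m c) = f m c"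
  using assms by (simp add: linear_ext_def)

lemma linear_ext_add:
  fixes f :: "'a \<Rightarrow> 'k::monoid_add \<Rightarrow> 'c::comm_monoid_add"
  assumes "\<And>m. f m 0 = 0" "\<And>m a b. f m (a + b) = f m a + f m b"
  shows "linear_ext f (p + q) = linear_ext f p + linear_ext f q"
proof -
  let ?K = "Poly_Mapping.keys p \<union> Poly_Mapping.keys q"
  have "linear_ext f r = (\<Sum>m\<in>?K. f m (Poly_Mapping.lookup r m))" if "Poly_Mapping.keys r \<subseteq> ?K" for r
    unfolding linear_ext_def using that assms(1) by (intro sum.mono_neutral_left) (auto simp: in_keys_iff)
  note * = this
  show ?thesis
    using *[of p] *[of q] *[of "p + q"] Poly_Mapping.keys_add[of p q]
    by (simp add: lookup_add assms(2) sum.distrib)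
qed

text \<open>Weights 0 and 1 give substitutions of 0 for some variables, weights with signs give
  signed monomial substitutions; both kinds occur below.\<close>

definition weighted_map :: "('m \<Rightarrow> 'l) \<Rightarrow> ('m \<Rightarrow> 'k::comm_ring_1) \<Rightarrow> ('m \<Rightarrow>\<^sub>0 'k) \<Rightarrow> ('l \<Rightarrow>\<^sub>0 'k)" where
  "weighted_map \<phi> \<epsilon> = linear_ext (\<lambda>m c. Poly_Mapping.single (\<phi> m) (\<epsilon> m * c))"

lemma weighted_map_single [simp]:
  "weighted_map \<phi> \<epsilon> (Poly_Mapping.single m c) = Poly_Mapping.single (\<phi> m) (\<epsilon> m * c)"
  by (simp add: weighted_map_def linear_ext_single)

lemma weighted_map_zero [simp]: "weighted_map \<phi> \<epsilon> 0 = 0"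
  by (simp add: weighted_map_def)

lemma weighted_map_add: "weighted_map \<phi> \<epsilon> (p + q) = weighted_map \<phi> \<epsilon> p + weighted_map \<phi> \<epsilon> q"
  by (simp add: weighted_map_def linear_ext_add algebra_simps single_add)

lemma weighted_map_diff: "weighted_map \<phi> \<epsilon> (p - q) = weighted_map \<phi> \<epsilon> p - weighted_map \<phi> \<epsilon> q"
  using weighted_map_add[of \<phi> \<epsilon> "p - q" q] by (simp add: algebra_simps)

lemma weighted_map_mult:
  fixes \<phi> :: "'m::monoid_add \<Rightarrow> 'l::monoid_add"
  assumes "\<And>a b. \<phi> (a + b) = \<phi> a + \<phi> b" "\<And>a b. \<epsilon> (a + b) = \<epsilon> a * \<epsilon> b"
  shows "weighted_map \<phi> \<epsilon> (p * q) = weighted_map \<phi> \<epsilon> p * weighted_map \<phi> \<epsilon> q"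
proof (induction p rule: poly_mapping_single_induct)
  case (single m c)
  show ?case
    by (induction q rule: poly_mapping_single_induct)
      (simp_all add: mult_single assms algebra_simps weighted_map_add)
qed (simp_all add: weighted_map_add algebra_simps)

lemma lookup_single_mult:
  fixes m :: "'m::cancel_comm_monoid_add" and c :: "'k::comm_ring_1"
  shows "Poly_Mapping.lookup (Poly_Mapping.single m c * p) (m + n) = c * Poly_Mapping.lookup p n"
proof (induction p rule: poly_mapping_single_induct)
  case (single k a)
  have "m + k = m + n \<longleftrightarrow> k = n" by simp
  then show ?case by (simp add: mult_single lookup_single when_def)
qed (simp_all add: lookup_add algebra_simps)

text \<open>The exponents of \<open>p\<close> can be compared through their \<open>d\<close>-values; an extremal one survives.\<close>

lemma binomial_mult_eq_0:
  fixes m n :: "'m::cancel_comm_monoid_add" and p :: "'m \<Rightarrow>\<^sub>0 'k::comm_ring_1" and d :: "'m \<Rightarrow> nat"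
  assumes add: "\<And>a b. d (a + b) = d a + d b" and less: "d m < d n"
    and eq: "p * (Poly_Mapping.single m 1 - Poly_Mapping.single n 1) = 0"
  shows "p = 0"
proof (rule ccontr)
  assume "p \<noteq> 0"
  then have ne: "Poly_Mapping.keys p \<noteq> {}" by simp
  have "Max (d ` Poly_Mapping.keys p) \<in> d ` Poly_Mapping.keys p"
    using ne by (intro Max_in) auto
  then obtain a where a: "a \<in> Poly_Mapping.keys p" "d a = Max (d ` Poly_Mapping.keys p)" by auto
  then have max: "d b \<le> d a" if "b \<in> Poly_Mapping.keys p" for b using that by simp
  have sing: "Poly_Mapping.single m 1 * p = Poly_Mapping.single n 1 * p"
    using eq by (simp add: algebra_simps)
  have "Poly_Mapping.lookup (Poly_Mapping.single n 1 * p) (n + a) \<noteq> 0"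
    using a(1) by (simp add: lookup_single_mult in_keys_iff)
  then have "n + a \<in> Poly_Mapping.keys (Poly_Mapping.single m 1 * p)"
    using sing by (simp add: in_keys_iff)
  then obtain b where "b \<in> Poly_Mapping.keys p" "n + a = m + b"
    using keys_mult[of "Poly_Mapping.single m 1" p] by (auto split: if_splits)
  moreover from this have "d n + d a = d m + d b" using add by metis
  ultimately show False using max less by fastforce
qed

section \<open>Ideals of two-minors indexed by a graph\<close>

interpretation ideal: module "(*) :: 'r::comm_ring_1 \<Rightarrow> 'r \<Rightarrow> 'r"
  by (rule module_mult_self)

declare ideal.scale_scale [simp del] \<comment> \<open>loops with \<open>mult.assoc\<close>\<close>

text \<open>This is the colon ideal of the span by \<open>h\<close>;
  \<open>diff_kill_vertex_mem\<close> will be applied to it.\<close>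

lemma ideal_colon_subspace: "ideal.subspace {q. q * h \<in> ideal.span B}"
  unfolding ideal.subspace_def
  by (auto simp: distrib_right mult.assoc intro: ideal.span_zero ideal.span_add ideal.span_scale)

lemma Var_dvd_single:
  assumes "Poly_Mapping.lookup m v \<noteq> 0"
  shows "(Var v :: ('n, 'k::field) S) dvd Poly_Mapping.single m c"
proof -
  let ?m = "m - Poly_Mapping.single v 1"
  have "m = Poly_Mapping.single v 1 + ?m"
    using assms by (intro poly_mapping_eqI) (auto simp: lookup_add lookup_minus lookup_single when_def)
  then have "Poly_Mapping.single m c = Var v * Poly_Mapping.single ?m c"
    by (simp add: Var_def mult_single)
  then show ?thesis by (rule dvdI)
qed

text \<open>The substitution of 0 for both variables of \<open>w\<close>, encoded as weight 0 on
  each monomial that contains one of them.\<close>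

definition kill_vertex :: "'n \<Rightarrow> ('n, 'k::field) S \<Rightarrow> ('n, 'k) S" where
  "kill_vertex w = weighted_map id
     (\<lambda>m. if Poly_Mapping.lookup m (XVar w) = 0 \<and> Poly_Mapping.lookup m (YVar w) = 0 then 1 else 0)"

lemma kill_vertex_zero [simp]: "kill_vertex w 0 = 0"
  and kill_vertex_add [simp]: "kill_vertex w (p + q) = kill_vertex w p + kill_vertex w q"
  and kill_vertex_diff [simp]: "kill_vertex w (p - q) = kill_vertex w p - kill_vertex w q"
  and kill_vertex_mult [simp]: "kill_vertex w (p * q) = kill_vertex w p * kill_vertex w q"
  unfolding kill_vertex_def
  by (simp_all add: weighted_map_add weighted_map_diff weighted_map_mult lookup_add)

text \<open>The graph operation of Ohtani's lemma: the neighbourhood of \<open>w\<close> becomes a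
  clique. Loops enter as well; they are harmless, as their minors are 0.\<close>

definition completion :: "('n \<times> 'n) set \<Rightarrow> 'n \<Rightarrow> ('n \<times> 'n) set" where
  "completion A w = A \<union> (A `` {w}) \<times> (A `` {w})"

text \<open>Vertices in \<open>D\<close> count as deleted, because the ideals below contain both
  entries of their columns.\<close>

definition simplicial :: "'n set \<Rightarrow> ('n \<times> 'n) set \<Rightarrow> 'n \<Rightarrow> bool" where
  "simplicial D A w \<longleftrightarrow> (\<forall>a b. a \<notin> D \<longrightarrow> b \<notin> D \<longrightarrow> (w, a) \<in> A \<longrightarrow> (w, b) \<in> A \<longrightarrow> (a, b) \<in> A)"

lemma sym_completion: "sym A \<Longrightarrow> sym (completion A w)"
  unfolding completion_def sym_def by auto

lemma refl_completion: "refl A \<Longrightarrow> refl (completion A w)"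
  unfolding completion_def refl_on_def by auto

text \<open>Two neighbours of \<open>w\<close> are already joined through \<open>w\<close>, so
  completion merges no components.\<close>

lemma rtrancl_completion:
  assumes "sym A"
  shows "(completion A w)\<^sup>* = A\<^sup>*"
proof (rule rtrancl_subset)
  show "completion A w \<subseteq> A\<^sup>*"
  proof
    fix e assume "e \<in> completion A w"
    then consider "e \<in> A" | "(fst e, w) \<in> A" "(w, snd e) \<in> A"
      using assms by (cases e) (auto simp: completion_def sym_def)
    then show "e \<in> A\<^sup>*"
      by cases (auto, metis prod.collapse converse_rtrancl_into_rtrancl r_into_rtrancl)
  qed
qed (auto simp: completion_def)

text \<open>If \<open>w\<close> is adjacent to \<open>v\<close>, all neighbours of \<open>v\<close>
  outside \<open>D\<close> are neighbours of \<open>w\<close>, and the new neighbourhood lies in the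
  new clique. Otherwise the neighbourhood of \<open>v\<close> does not change.\<close>

lemma simplicial_completion:
  assumes "sym A" "v \<notin> D" "w \<notin> D" "simplicial D A v"
  shows "simplicial D (completion A w) v"
  using assms unfolding simplicial_def completion_def sym_def by blast

lemma simplicial_completion_self:
  assumes "refl A" "sym A"
  shows "simplicial D (completion A w) w"
  using assms unfolding simplicial_def completion_def sym_def refl_on_def by blast

lemma simplicial_insert: "simplicial D A v \<Longrightarrow> simplicial (insert w D) A v"
  unfolding simplicial_def by blast


section \<open>Ideals of rotated minors and their decomposition at a vertex\<close>

context
  fixes \<chi> :: "'n \<Rightarrow> bool"
begin

text \<open>
  Rotating the column \<open>(x\<^sub>i, y\<^sub>i)\<close> to \<open>(-y\<^sub>i, x\<^sub>i)\<close> on one colour class turns \<open>g\<^sub>i\<^sub>j\<close> into a two-minor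
  whenever \<open>i\<close> and \<open>j\<close> have different colours, and keeps \<open>f\<^sub>i\<^sub>j\<close> when they have the same colour.
\<close>

definition top_var :: "'n \<Rightarrow> 'n var" where
  "top_var i = (if \<chi> i then YVar i else XVar i)"

definition bot_var :: "'n \<Rightarrow> 'n var" where
  "bot_var i = (if \<chi> i then XVar i else YVar i)"

definition top_entry :: "'n \<Rightarrow> ('n, 'k::field) S" where
  "top_entry i = Poly_Mapping.single (Poly_Mapping.single (top_var i) 1) (if \<chi> i then - 1 else 1)"

definition bot_entry :: "'n \<Rightarrow> ('n, 'k::field) S" where
  "bot_entry i = Poly_Mapping.single (Poly_Mapping.single (bot_var i) 1) 1"

definition minor :: "'n \<Rightarrow> 'n \<Rightarrow> ('n, 'k::field) S" where
  "minor a b = top_entry a * bot_entry b - top_entry b * bot_entry a"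

text \<open>Up to the rotation these generate the binomial edge ideal of \<open>A\<close>, enlarged
  by the columns in \<open>D\<close>. With \<open>D\<close> present, both ideals in Ohtani's lemma
  are again of this form.\<close>

definition minor_ideal_gens :: "'n set \<Rightarrow> ('n \<times> 'n) set \<Rightarrow> ('n, 'k::field) S set" where
  "minor_ideal_gens D A = top_entry ` D \<union> bot_entry ` D \<union> (\<lambda>(a, b). minor a b) ` A"

definition minor_ideal :: "'n set \<Rightarrow> ('n \<times> 'n) set \<Rightarrow> ('n, 'k::field) S set" where
  "minor_ideal D A = ideal.span (minor_ideal_gens D A)"

lemma minor_same_colour: "\<chi> a = \<chi> b \<Longrightarrow> minor a b = f_poly a b"
  by (simp add: minor_def f_poly_def top_entry_def bot_entry_def top_var_def bot_var_def
      Var_def mult_single add.commute single_uminus)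

lemma minor_different_colour: "\<chi> a \<noteq> \<chi> b \<Longrightarrow> minor a b = (if \<chi> a then - g_poly a b else g_poly a b)"
  by (auto simp add: minor_def g_poly_def top_entry_def bot_entry_def top_var_def bot_var_def
      Var_def mult_single add.commute single_uminus)

lemma minor_self [simp]: "minor a a = 0"
  by (simp add: minor_def)

lemma top_entry_mem: "d \<in> D \<Longrightarrow> top_entry d \<in> minor_ideal D A"
  and bot_entry_mem: "d \<in> D \<Longrightarrow> bot_entry d \<in> minor_ideal D A"
  and minor_mem: "(a, b) \<in> A \<Longrightarrow> minor a b \<in> minor_ideal D A"
  unfolding minor_ideal_def by (rule ideal.span_base; force simp: minor_ideal_gens_def)+

lemma minor_ideal_zero [simp]: "0 \<in> minor_ideal D A"
  and minor_ideal_add: "p \<in> minor_ideal D A \<Longrightarrow> q \<in> minor_ideal D A \<Longrightarrow> p + q \<in> minor_ideal D A"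
  and minor_ideal_diff: "p \<in> minor_ideal D A \<Longrightarrow> q \<in> minor_ideal D A \<Longrightarrow> p - q \<in> minor_ideal D A"
  and minor_ideal_mult: "p \<in> minor_ideal D A \<Longrightarrow> c * p \<in> minor_ideal D A"
  unfolding minor_ideal_def
  by (simp_all add: ideal.span_zero ideal.span_add ideal.span_diff ideal.span_scale)

lemma minor_ideal_uminus_iff [simp]: "- p \<in> minor_ideal D A \<longleftrightarrow> p \<in> minor_ideal D A"
  using minor_ideal_mult[of p D A "- 1"] minor_ideal_mult[of "- p" D A "- 1"] by auto

lemma minor_ideal_mono: "D \<subseteq> D' \<Longrightarrow> A \<subseteq> A' \<Longrightarrow> minor_ideal D A \<subseteq> minor_ideal D' A'"
  unfolding minor_ideal_def minor_ideal_gens_def by (intro ideal.span_mono) blast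

lemma minor_ideal_induct [consumes 1, case_names zero top bot minor]:
  assumes "p \<in> minor_ideal D A" "P 0"
    and "\<And>c d q. d \<in> D \<Longrightarrow> P q \<Longrightarrow> P (c * top_entry d + q)"
    and "\<And>c d q. d \<in> D \<Longrightarrow> P q \<Longrightarrow> P (c * bot_entry d + q)"
    and "\<And>c a b q. (a, b) \<in> A \<Longrightarrow> P q \<Longrightarrow> P (c * minor a b + q)"
  shows "P p"
  using assms(1) unfolding minor_ideal_def
  by (induction rule: ideal.span_induct_alt) (auto simp: minor_ideal_gens_def assms(2-))

lemma kill_vertex_top_entry [simp]: "kill_vertex w (top_entry a) = (if a = w then 0 else top_entry a)"
  and kill_vertex_bot_entry [simp]: "kill_vertex w (bot_entry a) = (if a = w then 0 else bot_entry a)"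
  by (auto simp: kill_vertex_def top_entry_def bot_entry_def top_var_def bot_var_def lookup_single when_def)

lemma kill_vertex_minor [simp]:
  "kill_vertex w (minor a b) = (if a = w \<or> b = w then 0 else minor a b)"
  by (simp add: minor_def)

text \<open>A monomial is either fixed by the substitution or divisible by a variable of
  \<open>w\<close>. \<open>Q\<close> is arbitrary because the lemma is applied to a colon
  ideal.\<close>

lemma diff_kill_vertex_mem:
  fixes Q :: "('n, 'k::field) S set"
  assumes Q: "ideal.subspace Q" and "top_entry w \<in> Q" "bot_entry w \<in> Q"
  shows "p - kill_vertex w p \<in> Q"
proof -
  have "- top_entry w \<in> Q" "- bot_entry w \<in> Q"
    using assms by (auto intro: ideal.subspace_neg)
  then have "Var (XVar w) \<in> Q" "Var (YVar w) \<in> Q"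
    using assms by (auto simp: top_entry_def bot_entry_def top_var_def bot_var_def Var_def single_uminus
        split: if_splits)
  then have Var: "q \<in> Q" if "Var (XVar w) dvd q \<or> Var (YVar w) dvd q" for q
    using that ideal.subspace_scale[OF Q] unfolding dvd_def by (metis mult.commute)
  show ?thesis
  proof (induction p rule: poly_mapping_single_induct)
    case zero
    then show ?case using Q by (simp add: ideal.subspace_0)
  next
    case (single m c)
    show ?case
      using Var[of "Poly_Mapping.single m c"] Var_dvd_single[of m] Q
      by (auto simp: kill_vertex_def ideal.subspace_0)
  next
    case (add p q)
    have "p + q - kill_vertex w (p + q) = (p - kill_vertex w p) + (q - kill_vertex w q)" by simp
    then show ?case using add Q by (metis ideal.subspace_add)
  qed
qed

text \<open>Expansion of a vanishing 3 by 3 determinant: columns \<open>w\<close>, \<open>a\<close>,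
  \<open>b\<close>, with the top (or bottom) row repeated.\<close>

lemma entry_mult_minor:
  shows "top_entry w * minor a b = top_entry a * minor w b - top_entry b * minor w a"
    and "bot_entry w * minor a b = bot_entry a * minor w b - bot_entry b * minor w a"
  by (simp_all add: minor_def algebra_simps)

lemma entry_mult_minor_mem:
  assumes "(w, a) \<in> A" "(w, b) \<in> A"
  shows "top_entry w * minor a b \<in> minor_ideal D A" "bot_entry w * minor a b \<in> minor_ideal D A"
  using assms by (subst entry_mult_minor, simp add: minor_ideal_diff minor_ideal_mult minor_mem)+

lemma kill_vertex_mem_minor_ideal:
  assumes "p \<in> minor_ideal (insert w D) A"
  shows "kill_vertex w p \<in> minor_ideal D A"
  using assms
  by (induction rule: minor_ideal_induct)
    (auto intro!: minor_ideal_add minor_ideal_mult top_entry_mem bot_entry_mem minor_mem)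

text \<open>Only a minor of a newly added pair needs an argument. It is fixed by the substitution,
  so the difference is \<open>c - kill_vertex w c\<close> times the minor, and both entries of
  column \<open>w\<close> multiply this minor into the ideal.\<close>

lemma diff_kill_vertex_mem_minor_ideal:
  fixes p :: "('n, 'k::field) S"
  assumes "sym A" "w \<notin> D" "p \<in> minor_ideal D (completion A w)"
  shows "p - kill_vertex w p \<in> minor_ideal D A"
proof -
  let ?I = "minor_ideal D A :: ('n, 'k) S set"
  have step: "c * h + q - kill_vertex w (c * h + q) \<in> ?I"
    if "q - kill_vertex w q \<in> ?I" "c * h - kill_vertex w (c * h) \<in> ?I" for c h q
    using minor_ideal_add[OF that(2,1)] by (simp add: algebra_simps)
  from assms(3) show ?thesis
  proof (induction rule: minor_ideal_induct)
    case zero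
    then show ?case by simp
  next
    case (top c d q)
    then show ?case using \<open>w \<notin> D\<close> by (intro step) (auto intro!: minor_ideal_diff minor_ideal_mult top_entry_mem)
  next
    case (bot c d q)
    then show ?case using \<open>w \<notin> D\<close> by (intro step) (auto intro!: minor_ideal_diff minor_ideal_mult bot_entry_mem)
  next
    case (minor c a b q)
    have "c * minor a b - kill_vertex w (c * minor a b) \<in> ?I"
    proof (cases "(a, b) \<in> A")
      case True
      then show ?thesis by (auto intro!: minor_ideal_diff minor_ideal_mult minor_mem)
    next
      case False
      with minor have ab: "(w, a) \<in> A" "(w, b) \<in> A" by (auto simp: completion_def)
      show ?thesis
      proof (cases "a = w \<or> b = w")
        case True
        \<comment> \<open>By symmetry a pair containing \<open>w\<close> is already in
          \<open>A\<close>, so this case is contradictory.\<close>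
        then have "a = w \<and> (a, b) \<in> A \<or> b = w \<and> (a, b) \<in> A"
          using ab assms(1) by (auto simp: sym_def)
        with False show ?thesis by simp
      next
        case ne: False
        have "c - kill_vertex w c \<in> {q. q * minor a b \<in> ideal.span (minor_ideal_gens D A)}"
          using entry_mult_minor_mem[OF ab]
          by (intro diff_kill_vertex_mem ideal_colon_subspace) (auto simp: minor_ideal_def)
        then show ?thesis using ne by (simp add: minor_ideal_def algebra_simps)
      qed
    qed
    then show ?case using minor by (intro step)
  qed
qed

text \<open>Ohtani's lemma on binomial edge ideals.\<close>

lemma minor_ideal_eq_Int:
  assumes "sym A" "w \<notin> D"
  shows "(minor_ideal D A :: ('n, 'k::field) S set) = minor_ideal D (completion A w) \<inter> minor_ideal (insert w D) A"
proof
  show "minor_ideal D A \<subseteq> (minor_ideal D (completion A w) \<inter> minor_ideal (insert w D) A :: ('n, 'k) S set)"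
    using minor_ideal_mono[of D D A "completion A w"] minor_ideal_mono[of D "insert w D" A A]
    by (auto simp: completion_def)
  show "minor_ideal D (completion A w) \<inter> minor_ideal (insert w D) A \<subseteq> (minor_ideal D A :: ('n, 'k) S set)"
  proof
    fix p :: "('n, 'k) S" assume "p \<in> minor_ideal D (completion A w) \<inter> minor_ideal (insert w D) A"
    \<comment> \<open>Each membership of \<open>p\<close> serves one summand: the completed graph
      the difference, the deletion of \<open>w\<close> the image.\<close>
    then have "(p - kill_vertex w p) + kill_vertex w p \<in> minor_ideal D A"
      using kill_vertex_mem_minor_ideal diff_kill_vertex_mem_minor_ideal[OF assms]
      by (intro minor_ideal_add) auto
    then show "p \<in> minor_ideal D A" by simp
  qed
qed

end

text \<open>Supplies two columns, one with an excess and one with a deficit, between which factors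
  will be exchanged.\<close>

lemma sum_eq_imp_ex_less:
  fixes f g :: "'a \<Rightarrow> nat"
  assumes "finite S" "sum f S = sum g S" "i \<in> S" "f i \<noteq> g i"
  shows "(\<exists>j\<in>S. f j < g j) \<and> (\<exists>j\<in>S. g j < f j)"
proof (intro conjI; rule ccontr)
  assume "\<not> (\<exists>j\<in>S. f j < g j)"
  then have "sum g S < sum f S"
    using assms by (intro sum_strict_mono_ex1) (auto simp: not_less intro!: bexI[of _ i] le_neq_trans)
  with assms show False by simp
next
  assume "\<not> (\<exists>j\<in>S. g j < f j)"
  then have "sum f S < sum g S"
    using assms by (intro sum_strict_mono_ex1) (auto simp: not_less intro!: bexI[of _ i] le_neq_trans)
  with assms show False by simp
qed

section \<open>Disjoint unions of cliques: the ideal as the kernel of a monomial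
  substitution\<close>

context
  fixes \<chi> :: "'n::finite \<Rightarrow> bool" and D :: "'n set" and A :: "('n \<times> 'n) set"
begin

lemma var_simps [simp]:
  "top_var \<chi> i = top_var \<chi> j \<longleftrightarrow> i = j" "bot_var \<chi> i = bot_var \<chi> j \<longleftrightarrow> i = j"
  "top_var \<chi> i \<noteq> bot_var \<chi> j" "bot_var \<chi> i \<noteq> top_var \<chi> j"
  by (auto simp: top_var_def bot_var_def)

lemma var_cases: obtains i where "v = top_var \<chi> i" | i where "v = bot_var \<chi> i"
  by (cases v) (auto simp: top_var_def bot_var_def split: if_splits; metis)+

text \<open>When all vertices outside \<open>D\<close> are simplicial, adjacent ones have the same
  \<open>vclass\<close>, so this set names the clique of \<open>i\<close>.\<close>

definition vclass :: "'n \<Rightarrow> 'n set" where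
  "vclass i = A `` {i} - D"

text \<open>
  For cliques \<open>C\<close> the column of \<open>i \<in> C\<close> is sent to \<open>s\<^sub>i (1, t\<^sub>C)\<close>: the kernel of this substitution
  is the ideal. The exponent of \<open>s\<^sub>i\<close> is stored at \<open>Inl i\<close> and that of \<open>t\<^sub>C\<close> at \<open>Inr C\<close>.
\<close>

definition class_exp :: "('n var \<Rightarrow>\<^sub>0 nat) \<Rightarrow> ('n + 'n set \<Rightarrow>\<^sub>0 nat)" where
  "class_exp m = (\<Sum>i\<in>UNIV.
     Poly_Mapping.single (Inl i) (Poly_Mapping.lookup m (top_var \<chi> i) + Poly_Mapping.lookup m (bot_var \<chi> i))
     + Poly_Mapping.single (Inr (vclass i)) (Poly_Mapping.lookup m (bot_var \<chi> i)))"

text \<open>The value 0 kills the columns in \<open>D\<close>; the sign cancels the one in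
  \<open>top_entry\<close>, so that every other entry has an image with coefficient 1.\<close>

definition class_sign :: "('n var \<Rightarrow>\<^sub>0 nat) \<Rightarrow> 'k::field" where
  "class_sign m =
     (if \<exists>d\<in>D. Poly_Mapping.lookup m (top_var \<chi> d) \<noteq> 0 \<or> Poly_Mapping.lookup m (bot_var \<chi> d) \<noteq> 0 then 0
      else (- 1) ^ (\<Sum>i | \<chi> i. Poly_Mapping.lookup m (top_var \<chi> i)))"

definition class_map :: "('n, 'k::field) S \<Rightarrow> (('n + 'n set \<Rightarrow>\<^sub>0 nat) \<Rightarrow>\<^sub>0 'k)" where
  "class_map = weighted_map class_exp class_sign"

lemma class_exp_add: "class_exp (m + m') = class_exp m + class_exp m'"
  by (simp add: class_exp_def lookup_add single_add sum.distrib ac_simps)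

lemma class_sign_add: "class_sign (m + m') = class_sign m * class_sign m'"
  by (auto simp: class_sign_def lookup_add sum.distrib power_add)

lemma class_map_zero [simp]: "class_map 0 = 0"
  and class_map_add: "class_map (p + q) = class_map p + class_map q"
  and class_map_diff: "class_map (p - q) = class_map p - class_map q"
  and class_map_mult: "class_map (p * q) = class_map p * class_map q"
  unfolding class_map_def
  by (simp_all add: weighted_map_add weighted_map_diff weighted_map_mult class_exp_add class_sign_add)

lemma class_exp_top_var: "class_exp (Poly_Mapping.single (top_var \<chi> i) 1) = Poly_Mapping.single (Inl i) 1"
  by (simp add: class_exp_def lookup_single when_def if_distrib[where f = "Poly_Mapping.single _"]
      sum.delta' cong: if_cong)

lemma class_exp_bot_var: "class_exp (Poly_Mapping.single (bot_var \<chi> i) 1)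
    = Poly_Mapping.single (Inl i) 1 + Poly_Mapping.single (Inr (vclass i)) 1"
  by (simp add: class_exp_def lookup_single when_def if_distrib[where f = "Poly_Mapping.single _"]
      sum.delta' sum.distrib cong: if_cong)

lemma class_sign_top_var:
  "class_sign (Poly_Mapping.single (top_var \<chi> i) 1) = (if i \<in> D then 0 else if \<chi> i then - 1 else 1)"
  by (auto simp: class_sign_def lookup_single when_def sum.delta')

lemma class_sign_bot_var: "class_sign (Poly_Mapping.single (bot_var \<chi> i) 1) = (if i \<in> D then 0 else 1)"
  by (auto simp: class_sign_def lookup_single when_def)

lemma class_map_top_entry:
  "class_map (top_entry \<chi> i) = (if i \<in> D then 0 else Poly_Mapping.single (Poly_Mapping.single (Inl i) 1) 1)"
  by (simp add: class_map_def top_entry_def class_exp_top_var class_sign_top_var del: One_nat_def)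

lemma class_map_bot_entry:
  "class_map (bot_entry \<chi> i) = (if i \<in> D then 0
     else Poly_Mapping.single (Poly_Mapping.single (Inl i) 1 + Poly_Mapping.single (Inr (vclass i)) 1) 1)"
  by (simp add: class_map_def bot_entry_def class_exp_bot_var class_sign_bot_var del: One_nat_def)

lemma class_map_minor:
  "class_map (minor \<chi> i j) = (if i \<in> D \<or> j \<in> D then 0 else
     Poly_Mapping.single (Poly_Mapping.single (Inl i) 1 + Poly_Mapping.single (Inl j) 1
       + Poly_Mapping.single (Inr (vclass j)) 1) 1
     - Poly_Mapping.single (Poly_Mapping.single (Inl i) 1 + Poly_Mapping.single (Inl j) 1
       + Poly_Mapping.single (Inr (vclass i)) 1) 1)"
  by (simp add: minor_def class_map_diff class_map_mult class_map_top_entry class_map_bot_entry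
      mult_single ac_simps del: One_nat_def)

lemma lookup_class_exp_Inl:
  "Poly_Mapping.lookup (class_exp m) (Inl i) = Poly_Mapping.lookup m (top_var \<chi> i) + Poly_Mapping.lookup m (bot_var \<chi> i)"
  by (simp add: class_exp_def lookup_sum lookup_add lookup_single when_def)

lemma lookup_class_exp_Inr:
  "Poly_Mapping.lookup (class_exp m) (Inr C) = (\<Sum>i | vclass i = C. Poly_Mapping.lookup m (bot_var \<chi> i))"
  by (simp add: class_exp_def lookup_sum lookup_add lookup_single when_def sum.inter_filter[symmetric])

text \<open>Weight 0 means that a variable of some column in \<open>D\<close> divides the
  monomial.\<close>

lemma single_mem_minor_ideal:
  assumes "class_sign m = (0 :: 'k::field)"
  shows "Poly_Mapping.single m (c :: 'k) \<in> minor_ideal \<chi> D A"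
proof -
  obtain d where d: "d \<in> D"
    "Poly_Mapping.lookup m (top_var \<chi> d) \<noteq> 0 \<or> Poly_Mapping.lookup m (bot_var \<chi> d) \<noteq> 0"
    using assms by (auto simp: class_sign_def split: if_splits)
  then obtain v where v: "v = top_var \<chi> d \<or> v = bot_var \<chi> d" "Poly_Mapping.lookup m v \<noteq> 0" by blast
  \<comment> \<open>The negative is included because on one colour class the top entry is minus its
    variable.\<close>
  have "0 - top_entry \<chi> d \<in> minor_ideal \<chi> D A" "top_entry \<chi> d \<in> minor_ideal \<chi> D A"
    "bot_entry \<chi> d \<in> minor_ideal \<chi> D A"
    using d by (simp_all only: minor_ideal_diff minor_ideal_zero top_entry_mem bot_entry_mem)
  then have "(Var v :: ('n, 'k) S) \<in> minor_ideal \<chi> D A"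
    using v(1) by (auto simp: top_entry_def bot_entry_def Var_def single_uminus split: if_splits)
  moreover obtain q :: "('n, 'k) S" where "Poly_Mapping.single m c = q * Var v"
    using Var_dvd_single[OF v(2), of c] by (auto simp: dvd_def mult.commute)
  ultimately show ?thesis by (simp add: minor_ideal_mult)
qed

text \<open>Monomials with the same image are linked by exchanges inside a clique: bottom of
  \<open>i\<close> times top of \<open>j\<close> becomes top of \<open>i\<close> times bottom of
  \<open>j\<close>, at the cost of a multiple of \<open>minor \<chi> j i\<close>. The induction is
  on the total excess of bottom exponents of \<open>m\<close> over \<open>m'\<close>, measured with
  truncated subtraction.\<close>

lemma single_diff_single_mem_minor_ideal:
  assumes refl: "refl A"
    and exp: "class_exp m = class_exp m'" and sign: "class_sign m \<noteq> (0::'k)" "class_sign m' \<noteq> (0::'k)"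
  shows "Poly_Mapping.single m (class_sign m) - Poly_Mapping.single m' (class_sign m' :: 'k::field)
    \<in> minor_ideal \<chi> D A"
  using exp sign(1)
proof (induction "\<Sum>i\<in>UNIV. Poly_Mapping.lookup m (bot_var \<chi> i) - Poly_Mapping.lookup m' (bot_var \<chi> i)"
    arbitrary: m rule: less_induct)
  case less
  let ?t = "\<lambda>m i. Poly_Mapping.lookup m (top_var \<chi> i)" and ?b = "\<lambda>m i. Poly_Mapping.lookup m (bot_var \<chi> i)"
  have deg: "?t m i + ?b m i = ?t m' i + ?b m' i" for i
    using less.prems(1) by (metis lookup_class_exp_Inl)
  show ?case
  proof (cases "\<forall>i. ?b m i = ?b m' i")
    case True
    with deg have "Poly_Mapping.lookup m v = Poly_Mapping.lookup m' v" for v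
      by (cases v rule: var_cases) (metis add_right_cancel)+
    then have "m = m'" by (rule poly_mapping_eqI)
    then show ?thesis by simp
  next
    case False
    then obtain i0 where "?b m i0 \<noteq> ?b m' i0" by blast
    \<comment> \<open>The exponent of the clique variable is the sum of the bottom exponents over
      the clique, so an excess in it is matched by a deficit.\<close>
    moreover have "(\<Sum>i | vclass i = vclass i0. ?b m i) = (\<Sum>i | vclass i = vclass i0. ?b m' i)"
      using less.prems(1) by (metis lookup_class_exp_Inr)
    ultimately obtain i j where ij: "vclass i = vclass j" "?b m' i < ?b m i" "?b m j < ?b m' j"
      using sum_eq_imp_ex_less[of "{i. vclass i = vclass i0}" "?b m" "?b m'" i0] by auto
    then have "i \<noteq> j" by auto
    have pos: "?b m i > 0" "?t m j > 0" using ij deg[of j] by auto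
    then have D: "i \<notin> D" "j \<notin> D" using less.prems(2) by (auto simp: class_sign_def split: if_splits)
    then have "i \<in> vclass i" using refl by (auto simp: vclass_def refl_on_def)
    then have "(j, i) \<in> A" using ij(1) by (auto simp: vclass_def)
    \<comment> \<open>\<open>m0\<close> is the part common to \<open>m\<close> and to the monomial
      \<open>m2\<close> obtained by the exchange.\<close>
    define m0 where "m0 = m - Poly_Mapping.single (bot_var \<chi> i) 1 - Poly_Mapping.single (top_var \<chi> j) 1"
    define m2 where "m2 = m0 + Poly_Mapping.single (top_var \<chi> i) 1 + Poly_Mapping.single (bot_var \<chi> j) 1"
    have m: "m = m0 + Poly_Mapping.single (bot_var \<chi> i) 1 + Poly_Mapping.single (top_var \<chi> j) 1"
      unfolding m0_def using pos
      by (intro poly_mapping_eqI) (auto simp: lookup_add lookup_minus lookup_single when_def)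
    have "class_exp m2 = class_exp m'"
      using less.prems(1) ij(1)
      by (simp add: m m2_def class_exp_add class_exp_top_var class_exp_bot_var ac_simps del: One_nat_def)
    moreover have "class_sign m2 \<noteq> (0::'k)"
      using less.prems(2) D
      by (simp add: m m2_def class_sign_add class_sign_top_var class_sign_bot_var del: One_nat_def split: if_splits)
    \<comment> \<open>The term at \<open>i\<close> drops by one; the term at \<open>j\<close> stays
      0, since \<open>m\<close> had a deficit there.\<close>
    moreover have "(\<Sum>k\<in>UNIV. ?b m2 k - ?b m' k) < (\<Sum>k\<in>UNIV. ?b m k - ?b m' k)"
    proof (rule sum_strict_mono_ex1)
      have "?b m2 k = (if k = j then ?b m k + 1 else if k = i then ?b m k - 1 else ?b m k)" for k
        using \<open>i \<noteq> j\<close> by (simp add: m m2_def lookup_add lookup_single when_def)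
      then show "\<forall>k\<in>UNIV. ?b m2 k - ?b m' k \<le> ?b m k - ?b m' k"
        and "\<exists>k\<in>UNIV. ?b m2 k - ?b m' k < ?b m k - ?b m' k"
        using ij \<open>i \<noteq> j\<close> by (auto intro!: exI[of _ i])
    qed simp
    ultimately have IH: "Poly_Mapping.single m2 (class_sign m2) - Poly_Mapping.single m' (class_sign m' :: 'k)
        \<in> minor_ideal \<chi> D A"
      by (intro less.hyps)
    have "Poly_Mapping.single m (class_sign m) - Poly_Mapping.single m2 (class_sign m2 :: 'k)
        = Poly_Mapping.single m0 (class_sign m0) * minor \<chi> j i"
      using D by (simp add: m m2_def minor_def top_entry_def bot_entry_def mult_single class_sign_add
          class_sign_top_var class_sign_bot_var right_diff_distrib ac_simps del: One_nat_def)
    then have "Poly_Mapping.single m (class_sign m) - Poly_Mapping.single m2 (class_sign m2 :: 'k)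
        \<in> minor_ideal \<chi> D A"
      using \<open>(j, i) \<in> A\<close> by (simp add: minor_ideal_mult minor_mem)
    from minor_ideal_add[OF this IH] show ?thesis by simp
  qed
qed

text \<open>Generators are sent to 0 because adjacent columns outside \<open>D\<close> share their
  clique variable. Conversely, \<open>lift\<close> sends each image monomial back to a chosen
  preimage, and \<open>p\<close> is congruent to \<open>lift (class_map p)\<close> modulo the
  ideal.\<close>

lemma minor_ideal_eq_kernel:
  assumes "refl A" "sym A" "\<And>w. w \<notin> D \<Longrightarrow> simplicial D A w"
  shows "p \<in> minor_ideal \<chi> D A \<longleftrightarrow> class_map (p :: ('n, 'k::field) S) = 0"
proof
  assume "p \<in> minor_ideal \<chi> D A"
  then show "class_map p = 0"
  proof (induction rule: minor_ideal_induct)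
    case (minor c a b q)
    have "vclass a = vclass b" if "a \<notin> D" "b \<notin> D"
      using minor(1) assms that unfolding vclass_def simplicial_def sym_def refl_on_def by blast
    then show ?case using minor by (simp add: class_map_add class_map_mult class_map_minor)
  qed (simp_all add: class_map_add class_map_mult class_map_top_entry class_map_bot_entry)
next
  define rep where "rep \<kappa> = (SOME m. class_exp m = \<kappa> \<and> class_sign m \<noteq> (0::'k))" for \<kappa>
  \<comment> \<open>A nonzero weight is 1 or -1, hence its own inverse; multiplying by it undoes the
    weight of the representative.\<close>
  define lift where "lift = linear_ext (\<lambda>\<kappa> c. Poly_Mapping.single (rep \<kappa>) (class_sign (rep \<kappa>) * (c::'k)))"
  have lift_add: "lift (q + r) = lift q + lift r" for q r
    unfolding lift_def by (rule linear_ext_add) (simp_all add: algebra_simps single_add)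
  have "p - lift (class_map p) \<in> minor_ideal \<chi> D A"
  proof (induction p rule: poly_mapping_single_induct)
    case zero
    then show ?case by (simp add: lift_def)
  next
    case (single m c)
    have lift: "lift (class_map (Poly_Mapping.single m c))
        = Poly_Mapping.single (rep (class_exp m)) (class_sign (rep (class_exp m)) * (class_sign m * c))"
      unfolding lift_def class_map_def by (simp add: linear_ext_single)
    show ?case
    proof (cases "class_sign m = (0::'k)")
      case True
      then show ?thesis by (simp add: lift single_mem_minor_ideal)
    next
      case False
      let ?r = "rep (class_exp m)"
      have r: "class_exp ?r = class_exp m" "class_sign ?r \<noteq> (0::'k)"
        unfolding rep_def using someI[of "\<lambda>m'. class_exp m' = class_exp m \<and> class_sign m' \<noteq> (0::'k)" m] False
        by auto
      have "class_sign m * class_sign m = (1::'k)"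
        using False unfolding class_sign_def
        by (simp add: power_mult_distrib[symmetric] split: if_split_asm)
      then have "Poly_Mapping.single m c - lift (class_map (Poly_Mapping.single m c))
        = Poly_Mapping.single 0 (class_sign m * c)
          * (Poly_Mapping.single m (class_sign m) - Poly_Mapping.single ?r (class_sign ?r))"
        unfolding lift by (simp add: right_diff_distrib mult_single ac_simps)
      then show ?thesis
        using single_diff_single_mem_minor_ideal[OF assms(1) r(1)[symmetric] False r(2)]
        by (simp add: minor_ideal_mult)
    qed
  next
    case (add p q)
    from minor_ideal_add[OF this] show ?case by (simp add: class_map_add lift_add algebra_simps)
  qed
  moreover assume "class_map p = 0"
  ultimately show "p \<in> minor_ideal \<chi> D A" by (simp add: lift_def)
qed

text \<open>The minor is sent to a binomial whose terms carry the variables of two different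
  cliques. Such a binomial is no zero divisor, as the exponent of the clique variable of
  \<open>u\<close> separates its terms.\<close>

lemma minor_regular_base:
  fixes p :: "('n, 'k::field) S"
  assumes A: "refl A" "sym A" "\<And>w. w \<notin> D \<Longrightarrow> simplicial D A w"
    and uv: "u \<notin> D" "v \<notin> D" "(u, v) \<notin> A"
    and p: "p * minor \<chi> u v \<in> minor_ideal \<chi> D A"
  shows "p \<in> minor_ideal \<chi> D A"
proof -
  have "v \<in> vclass v" "v \<notin> vclass u"
    using A(1) uv by (auto simp: vclass_def refl_on_def)
  then have ne: "vclass v \<noteq> vclass u" by blast
  let ?I = "Poly_Mapping.single (Inl u) 1 + Poly_Mapping.single (Inl v) (1::nat)"
  let ?m = "?I + Poly_Mapping.single (Inr (vclass v)) 1" and ?n = "?I + Poly_Mapping.single (Inr (vclass u)) 1"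
  have "class_map p * (Poly_Mapping.single ?m 1 - Poly_Mapping.single ?n 1) = 0"
    using p uv by (simp add: minor_ideal_eq_kernel[OF A] class_map_mult class_map_minor)
  then have "class_map p = 0"
    by (rule binomial_mult_eq_0[where d = "\<lambda>m. Poly_Mapping.lookup m (Inr (vclass u))", rotated 2])
      (use ne in \<open>auto simp: lookup_add lookup_single when_def\<close>)
  then show ?thesis by (simp add: minor_ideal_eq_kernel[OF A])
qed

end

text \<open>Induction on the number of non-simplicial vertices outside \<open>D\<close>. Completing
  at such a \<open>w\<close> makes it simplicial and spoils no other vertex; deleting it removes it
  from the count. Since \<open>u\<close> and \<open>v\<close> are simplicial, they differ from
  \<open>w\<close> and survive in both ideals with all hypotheses.\<close>

lemma minor_regular:
  fixes \<chi> :: "'n::finite \<Rightarrow> bool" and p :: "('n, 'k::field) S"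
  assumes "refl A" "sym A" "u \<notin> D" "v \<notin> D" "simplicial D A u" "simplicial D A v" "(u, v) \<notin> A\<^sup>*"
    and "p * minor \<chi> u v \<in> minor_ideal \<chi> D A"
  shows "p \<in> minor_ideal \<chi> D A"
  using assms
proof (induction "card {w. w \<notin> D \<and> \<not> simplicial D A w}" arbitrary: D A rule: less_induct)
  case less
  show ?case
  proof (cases "\<forall>w. w \<notin> D \<longrightarrow> simplicial D A w")
    case True
    then show ?thesis using less.prems by (intro minor_regular_base[of A D u v p \<chi>]) auto
  next
    case False
    then obtain w where w: "w \<notin> D" "\<not> simplicial D A w" by blast
    then have ne: "u \<noteq> w" "v \<noteq> w" using less.prems by auto
    have split: "minor_ideal \<chi> D A = (minor_ideal \<chi> D (completion A w) \<inter> minor_ideal \<chi> (insert w D) A :: ('n, 'k) S set)"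
      using less.prems(2) w(1) by (rule minor_ideal_eq_Int)
    have "p \<in> minor_ideal \<chi> D (completion A w)"
    proof (rule less.hyps)
      show "card {x. x \<notin> D \<and> \<not> simplicial D (completion A w) x} < card {x. x \<notin> D \<and> \<not> simplicial D A x}"
        using w simplicial_completion[OF less.prems(2) _ w(1)] simplicial_completion_self[OF less.prems(1,2)]
        by (intro psubset_card_mono) (simp, blast)
    qed (use less.prems w split in \<open>auto simp: rtrancl_completion sym_completion refl_completion simplicial_completion\<close>)
    moreover have "p \<in> minor_ideal \<chi> (insert w D) A"
    proof (rule less.hyps)
      show "card {x. x \<notin> insert w D \<and> \<not> simplicial (insert w D) A x} < card {x. x \<notin> D \<and> \<not> simplicial D A x}"
        using w simplicial_insert[of D A _ w] by (intro psubset_card_mono) auto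
    qed (use less.prems ne split in \<open>auto simp: simplicial_insert\<close>)
    ultimately show ?thesis using split by blast
  qed
qed

section \<open>Trees\<close>

definition adjacency :: "'n set set \<Rightarrow> ('n \<times> 'n) set" where
  "adjacency F = {(a, b). {a, b} \<in> F}"

lemma sym_adjacency: "sym (adjacency F)"
  by (auto simp: adjacency_def sym_def insert_commute)

lemma rtrancl_adjacency_commute: "(a, b) \<in> (adjacency F)\<^sup>* \<longleftrightarrow> (b, a) \<in> (adjacency F)\<^sup>*"
  by (meson sym_adjacency sym_rtrancl symD)

lemma rtrancl_imp_distinct_path:
  assumes "(u, v) \<in> r\<^sup>*"
  shows "\<exists>vs. vs \<noteq> [] \<and> hd vs = u \<and> last vs = v \<and> distinct vs \<and> successively (\<lambda>a b. (a, b) \<in> r) vs"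
  using assms
proof (induction rule: rtrancl_induct)
  case base
  show ?case by (intro exI[of _ "[u]"]) simp
next
  case (step y z)
  then obtain vs where vs: "vs \<noteq> []" "hd vs = u" "last vs = y" "distinct vs"
    "successively (\<lambda>a b. (a, b) \<in> r) vs" by blast
  show ?case
  proof (cases "z \<in> set vs")
    \<comment> \<open>The path has returned to a vertex already visited and is cut back to
      it.\<close>
    case True
    then obtain as bs where split: "vs = (as @ [z]) @ bs" by (metis append.assoc append_Cons append_Nil split_list)
    then have "successively (\<lambda>a b. (a, b) \<in> r) (as @ [z])"
      using vs(5) successively_append_iff by blast
    then show ?thesis using vs split
      by (intro exI[of _ "as @ [z]"]) (cases as; auto)
  next
    case False
    then show ?thesis using vs step.hyps(2)
      by (intro exI[of _ "vs @ [z]"]) (auto simp: successively_append_iff)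
  qed
qed

lemma tree_edge_ne: "tree E \<Longrightarrow> {u, v} \<in> E \<Longrightarrow> u \<noteq> v"
  by (auto simp: tree_def simple_graph_def)

lemma tree_edge_cases:
  assumes "tree E" "e \<in> E"
  obtains u v where "e = {u, v}" "u \<noteq> v"
  using assms by (auto simp: tree_def simple_graph_def card_2_iff)

text \<open>A path from \<open>u\<close> to \<open>v\<close> in \<open>F\<close> would close to a
  cycle with the edge \<open>{u, v}\<close>.\<close>

lemma tree_bridge:
  assumes "tree E" "{u, v} \<in> E" "F \<subseteq> E" "{u, v} \<notin> F"
  shows "(u, v) \<notin> (adjacency F)\<^sup>*"
proof
  assume "(u, v) \<in> (adjacency F)\<^sup>*"
  then obtain vs where vs: "vs \<noteq> []" "hd vs = u" "last vs = v" "distinct vs"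
    "successively (\<lambda>a b. (a, b) \<in> adjacency F) vs"
    using rtrancl_imp_distinct_path by metis
  have path: "successively (\<lambda>a b. {a, b} \<in> F) vs"
    using vs(5) by (simp add: adjacency_def)
  \<comment> \<open>One vertex would give \<open>u = v\<close>, and two would put
    \<open>{u, v}\<close> into \<open>F\<close>.\<close>
  have "3 \<le> length vs"
  proof (rule ccontr)
    assume "\<not> 3 \<le> length vs"
    then consider a where "vs = [a]" | a b where "vs = [a, b]"
      using vs(1) by (cases vs; cases "tl vs"; cases "tl (tl vs)") auto
    then show False using vs path assms(4) tree_edge_ne[OF assms(1,2)] by cases auto
  qed
  moreover have "successively (\<lambda>a b. {a, b} \<in> E) vs"
    using path assms(3) by (elim successively_mono) auto
  moreover have "{last vs, hd vs} \<in> E"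
    using vs assms(2) by (simp add: insert_commute)
  ultimately have "graph_cycle E vs" using vs(4) by (simp add: graph_cycle_def)
  then show False using assms(1) by (auto simp: tree_def)
qed

lemma tree_no_triangle:
  assumes "tree E" "{i, j} \<in> E" "{i, k} \<in> E" "j \<noteq> k"
  shows "{j, k} \<notin> E"
proof
  assume "{j, k} \<in> E"
  have "i \<noteq> j" "i \<noteq> k" using assms tree_edge_ne by metis+
  then have "(j, i) \<in> adjacency {{i, j}, {i, k}}" "(i, k) \<in> adjacency {{i, j}, {i, k}}" "{j, k} \<notin> {{i, j}, {i, k}}"
    using assms(4) by (auto simp: adjacency_def doubleton_eq_iff)
  then show False
    using tree_bridge[OF assms(1) \<open>{j, k} \<in> E\<close>, of "{{i, j}, {i, k}}"] assms
    by (meson converse_rtrancl_into_rtrancl empty_subsetI insert_subset r_into_rtrancl)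
qed

text \<open>Edges are added one at a time. If a new edge joins equal colours, the colours are
  exchanged on the old component of \<open>v\<close>, which does not contain
  \<open>u\<close>.\<close>

lemma tree_two_colourable:
  fixes E :: "'n::finite set set"
  assumes "tree E"
  shows "\<exists>\<chi> :: 'n \<Rightarrow> bool. \<forall>a b. {a, b} \<in> E \<longrightarrow> \<chi> a \<noteq> \<chi> b"
proof -
  have "\<exists>\<chi> :: 'n \<Rightarrow> bool. \<forall>a b. {a, b} \<in> F \<longrightarrow> \<chi> a \<noteq> \<chi> b" if "finite F" "F \<subseteq> E" for F
    using that
  proof (induction rule: finite_induct)
    case (insert e F)
    then obtain \<chi> :: "'n \<Rightarrow> bool" where \<chi>: "\<forall>a b. {a, b} \<in> F \<longrightarrow> \<chi> a \<noteq> \<chi> b" by auto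
    obtain u v where e: "e = {u, v}" "u \<noteq> v" using tree_edge_cases assms insert.prems by blast
    let ?C = "{x. (v, x) \<in> (adjacency F)\<^sup>*}"
    show ?case
    proof (cases "\<chi> u = \<chi> v")
      case False
      then show ?thesis using \<chi> e by (intro exI[of _ \<chi>]) (auto simp: doubleton_eq_iff)
    next
      case True
      have C: "a \<in> ?C \<longleftrightarrow> b \<in> ?C" if "{a, b} \<in> F" for a b
        using that sym_adjacency[of F] by (auto simp: adjacency_def sym_def intro: rtrancl_into_rtrancl)
      have "u \<notin> ?C"
        using tree_bridge[OF assms, of u v F] insert e rtrancl_adjacency_commute[of v u F] by auto
      then show ?thesis
        \<comment> \<open>The inequality of truth values is an exclusive or: it flips the colour
          exactly on \<open>?C\<close>.\<close>
        using \<chi> C e True by (intro exI[of _ "\<lambda>x. \<chi> x \<noteq> (x \<in> ?C)"]) (auto simp: doubleton_eq_iff)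
    qed
  qed auto
  then show ?thesis by simp
qed

section \<open>Generation\<close>

lemma LSS_map_add: "LSS_map E (v + w) = LSS_map E v + LSS_map E w"
  and LSS_map_diff: "LSS_map E (v - w) = LSS_map E v - LSS_map E w"
  and LSS_map_scale: "LSS_map E (scale c v) = c * LSS_map E v"
  by (simp_all add: LSS_map_def lookup_add lookup_minus distrib_right left_diff_distrib sum.distrib
      sum_subtractf sum_distrib_left mult.assoc)

lemma subspace_free_on: "free_module.subspace (free_on B)"
  by (simp add: free_on_eq_span)

lemma subspace_first_syzygy: "free_module.subspace (first_syzygy E)"
  using subspace_free_on[of E] unfolding free_module.subspace_def first_syzygy_def
  by (auto simp: LSS_map_add LSS_map_scale) (simp add: LSS_map_def)

lemma basis_vec_free_on: "b \<in> B \<Longrightarrow> basis_vec b \<in> free_on B"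
  by (simp add: free_on_eq_span free_module.span_base)

lemma f_poly_commute: "f_poly j i = - f_poly i j"
  by (simp add: f_poly_def)

lemma koszul_syz_mem:
  assumes "finite E" "d \<in> E" "e \<in> E"
  shows "koszul_syz (d, e) \<in> first_syzygy E"
  using assms
  by (simp add: first_syzygy_def koszul_syz_def basis_vec_free_on LSS_map_diff LSS_map_scale
      LSS_map_basis_vec mult.commute free_module.subspace_diff[OF subspace_free_on]
      free_module.subspace_scale[OF subspace_free_on])

lemma claw_syz_mem:
  assumes "finite E" "{i, j} \<in> E" "{i, k} \<in> E" "{i, l} \<in> E"
  shows "claw_syz (i, j, k, l) \<in> first_syzygy E"
proof -
  \<comment> \<open>A 3 by 3 determinant with columns \<open>j\<close>, \<open>k\<close>,
    \<open>l\<close>: its first row, the \<open>g_poly i\<close>, is the combination of the rows of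
    x and y with coefficients \<open>var_x i\<close> and \<open>var_y i\<close>.\<close>
  have "f_poly k l * g_poly i j - f_poly j l * g_poly i k + f_poly j k * g_poly i l = 0"
    by (simp add: g_poly_def f_poly_def algebra_simps)
  then show ?thesis
    using assms
    by (simp add: first_syzygy_def claw_syz_def basis_vec_free_on LSS_map_diff LSS_map_add LSS_map_scale
        LSS_map_basis_vec free_module.subspace_diff[OF subspace_free_on]
        free_module.subspace_add[OF subspace_free_on] free_module.subspace_scale[OF subspace_free_on])
qed

lemma koszul_syz_swap: "koszul_syz (e, d) = - koszul_syz (d, e)"
  by (simp add: koszul_syz_def)

lemma claw_syz_swap:
  shows "claw_syz (i, k, j, l) = - claw_syz (i, j, k, l)"
    and "claw_syz (i, j, l, k) = - claw_syz (i, j, k, l)"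
  by (simp_all add: claw_syz_def f_poly_commute[of j k] f_poly_commute[of k l])

lemma subspace_lookup_image:
  assumes "free_module.subspace N"
  shows "ideal.subspace ((\<lambda>t. Poly_Mapping.lookup t e) ` N)"
proof (rule ideal.subspaceI)
  show "0 \<in> (\<lambda>t. Poly_Mapping.lookup t e) ` N"
    using free_module.subspace_0[OF assms] by (intro image_eqI[of _ _ 0]) auto
next
  fix p q assume "p \<in> (\<lambda>t. Poly_Mapping.lookup t e) ` N" "q \<in> (\<lambda>t. Poly_Mapping.lookup t e) ` N"
  then obtain s t where "s \<in> N" "t \<in> N" "p = Poly_Mapping.lookup s e" "q = Poly_Mapping.lookup t e"
    by blast
  then show "p + q \<in> (\<lambda>t. Poly_Mapping.lookup t e) ` N"
    using free_module.subspace_add[OF assms] by (intro image_eqI[of _ _ "s + t"]) (auto simp: lookup_add)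
next
  fix c p assume "p \<in> (\<lambda>t. Poly_Mapping.lookup t e) ` N"
  then obtain t where "t \<in> N" "p = Poly_Mapping.lookup t e" by blast
  then show "c * p \<in> (\<lambda>t. Poly_Mapping.lookup t e) ` N"
    using free_module.subspace_scale[OF assms] by (intro image_eqI[of _ _ "scale c t"]) auto
qed

text \<open>Induction on \<open>F\<close>: an element of \<open>M\<close> with the same coefficient
  at the new edge is subtracted, which leaves a syzygy on the old edges. Claws are assumed in
  \<open>M\<close> for every order of the leaves, so that the new edge can always come last.\<close>

lemma syzygy_mem_generated:
  fixes E F :: "'n::{finite, linorder} set set" and M :: "('n set \<Rightarrow>\<^sub>0 ('n, 'k::field) S) set"
  assumes tree: "tree E" and M: "free_module.subspace M"
    and koszul: "\<And>d e. d \<in> E \<Longrightarrow> e \<in> E \<Longrightarrow> d \<noteq> e \<Longrightarrow> koszul_syz (d, e) \<in> M"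
    and claw: "\<And>i j k l. {i, j} \<in> E \<Longrightarrow> {i, k} \<in> E \<Longrightarrow> {i, l} \<in> E \<Longrightarrow> distinct [j, k, l] \<Longrightarrow>
      claw_syz (i, j, k, l) \<in> M"
    and "F \<subseteq> E" "s \<in> first_syzygy F"
  shows "s \<in> M"
proof -
  obtain \<chi> :: "'n \<Rightarrow> bool" where "\<forall>a b. {a, b} \<in> E \<longrightarrow> \<chi> a \<noteq> \<chi> b"
    using tree_two_colourable[OF tree] by blast
  then have \<chi>: "\<chi> a \<noteq> \<chi> b" if "{a, b} \<in> E" for a b using that by blast
  have "finite F" by simp
  then show ?thesis
    using assms(5,6)
  proof (induction arbitrary: s rule: finite_induct)
    case empty
    then show ?case using M by (simp add: first_syzygy_def free_on_def free_module.subspace_0)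
  next
    case (insert e F)
    note FE = \<open>insert e F \<subseteq> E\<close>
    obtain u v where e: "e = {u, v}" "u \<noteq> v" using tree_edge_cases[OF tree] FE by blast
    have uv: "(u, v) \<notin> (adjacency F)\<^sup>*"
      using tree_bridge[OF tree, of u v F] FE insert.hyps e by auto
    \<comment> \<open>Loops make the relation reflexive without changing the ideal. Completing at
      \<open>u\<close> and then at \<open>v\<close> makes both simplicial, since the second
      completion preserves this for \<open>u\<close>.\<close>
    define A0 where "A0 = adjacency F \<union> Id"
    define A where "A = completion (completion A0 u) v"
    have A0: "refl A0" "sym A0"
      using sym_adjacency[of F] by (auto simp: A0_def refl_on_def sym_def)
    then have A: "refl A" "sym A" "simplicial {} A u" "simplicial {} A v" "(u, v) \<notin> A\<^sup>*"
      using uv by (simp_all add: A_def refl_completion sym_completion simplicial_completion_self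
          simplicial_completion rtrancl_completion) (simp add: A0_def)
    let ?I = "minor_ideal \<chi> {} A :: ('n, 'k) S set"
    let ?N = "M \<inter> first_syzygy (insert e F)"
    have N: "free_module.subspace ?N"
      using M subspace_first_syzygy by (rule free_module.subspace_inter)
    \<comment> \<open>The ideal of all coefficients at the new edge that elements of
      \<open>M\<close> supported on \<open>insert e F\<close> can have.\<close>
    define Q where "Q = (\<lambda>t. Poly_Mapping.lookup t e) ` ?N"
    have Q_I: "a \<in> Q" if "t \<in> M" "t \<in> first_syzygy (insert e F)" "Poly_Mapping.lookup t e = a" for t a
      using that by (auto simp: Q_def)
    have Q: "ideal.subspace Q"
      unfolding Q_def using N by (rule subspace_lookup_image)
    have edge: "minor \<chi> a b \<in> Q" if "{a, b} \<in> F" for a b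
    proof -
      have ne: "{a, b} \<noteq> e" using that insert.hyps by blast
      then have "koszul_syz ({a, b}, e) \<in> M" using koszul that FE by blast
      moreover have "Poly_Mapping.lookup (koszul_syz ({a, b}, e)) e = g_poly a b"
        using ne by (simp add: koszul_syz_def lookup_minus basis_vec_def lookup_single)
      moreover have "koszul_syz ({a, b}, e) \<in> first_syzygy (insert e F)"
        using that by (intro koszul_syz_mem) auto
      ultimately have "g_poly a b \<in> Q" using Q_I by blast
      then have "g_poly a b \<in> Q" "- g_poly a b \<in> Q" using ideal.subspace_neg[OF Q] by blast+
      then show ?thesis using \<chi> that FE by (auto simp: minor_different_colour)
    qed
    \<comment> \<open>The other end \<open>w'\<close> of the new edge is the third leaf of a claw
      with center \<open>w\<close>, whose coefficient at \<open>e\<close> is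
      \<open>f_poly a b\<close>. If a loop is involved, the minor is 0 or belongs to an old
      edge.\<close>
    have star: "minor \<chi> a b \<in> Q" if w: "(w, a) \<in> A0" "(w, b) \<in> A0" and ew: "e = {w, w'}" for w w' a b
    proof -
      consider "a = b" | "{a, b} \<in> F" | "a \<noteq> b" "{w, a} \<in> F" "{w, b} \<in> F"
        using w by (auto simp: A0_def adjacency_def insert_commute)
      then show ?thesis
      proof cases
        case 1
        then show ?thesis using Q by (simp add: ideal.subspace_0)
      next
        case 2
        then show ?thesis by (rule edge)
      next
        case 3
        then have ne: "{w, a} \<noteq> e" "{w, b} \<noteq> e" "a \<noteq> w'" "b \<noteq> w'" using insert.hyps ew by auto
        then have "claw_syz (w, a, b, w') \<in> M" using 3 ew FE by (intro claw) auto
        moreover have "claw_syz (w, a, b, w') \<in> first_syzygy (insert e F)"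
          using 3 ew by (intro claw_syz_mem) auto
        moreover have "Poly_Mapping.lookup (claw_syz (w, a, b, w')) e = f_poly a b"
          using ne ew by (simp add: claw_syz_def lookup_minus lookup_add basis_vec_def lookup_single when_def)
        moreover have "\<chi> a = \<chi> b" using \<chi>[of w a] \<chi>[of w b] 3 FE by auto
        ultimately show ?thesis using Q_I by (simp add: minor_same_colour)
      qed
    qed
    \<comment> \<open>Since \<open>u\<close> and \<open>v\<close> are not adjacent, completing at
      \<open>u\<close> does not enlarge the neighbourhood of \<open>v\<close>.\<close>
    have "(u, v) \<notin> A0" using uv e by (auto simp: A0_def)
    then have A_cases: "(a, b) \<in> A0 \<or> (u, a) \<in> A0 \<and> (u, b) \<in> A0 \<or> (v, a) \<in> A0 \<and> (v, b) \<in> A0"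
      if "(a, b) \<in> A" for a b
      using that by (auto simp: A_def completion_def)
    have "?I \<subseteq> Q"
      unfolding minor_ideal_def
    proof (rule ideal.span_minimal[OF _ Q], rule subsetI)
      fix x assume "x \<in> (minor_ideal_gens \<chi> {} A :: ('n, 'k) S set)"
      then obtain a b where ab: "(a, b) \<in> A" "x = minor \<chi> a b" by (auto simp: minor_ideal_gens_def)
      from A_cases[OF ab(1)] consider "a = b" | "{a, b} \<in> F" | "(u, a) \<in> A0 \<and> (u, b) \<in> A0" | "(v, a) \<in> A0 \<and> (v, b) \<in> A0"
        by (auto simp: A0_def adjacency_def)
      then show "x \<in> Q"
      proof cases
        case 1
        then show ?thesis using ab Q by (simp add: ideal.subspace_0)
      next
        case 2
        then show ?thesis using ab edge by simp
      next
        case 3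
        then show ?thesis using ab star[of u a b v] e by simp
      next
        case 4
        then show ?thesis using ab star[of v a b u] e by (simp add: insert_commute)
      qed
    qed
    \<comment> \<open>The syzygy relation puts the coefficient times \<open>g_poly u v\<close> into
      the ideal of the old edges; regularity modulo \<open>?I\<close> removes the factor.\<close>
    moreover have "Poly_Mapping.lookup s e \<in> ?I"
    proof -
      have "Poly_Mapping.lookup s d * g_edge d \<in> ?I" if "d \<in> F" for d
      proof -
        have "d \<in> E" using that FE by blast
        then obtain a b where d: "d = {a, b}" by (rule tree_edge_cases[OF tree])
        have "(a, b) \<in> A" using that d by (auto simp: A_def A0_def completion_def adjacency_def)
        then have "minor \<chi> a b \<in> ?I" by (rule minor_mem)
        moreover have "\<chi> a \<noteq> \<chi> b" using \<chi>[of a b] that FE d by blast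
        ultimately have "g_poly a b \<in> ?I" by (simp add: minor_different_colour split: if_split_asm)
        then show ?thesis using d by (simp add: minor_ideal_mult)
      qed
      then have "(\<Sum>d\<in>F. Poly_Mapping.lookup s d * g_edge d) \<in> ?I"
        unfolding minor_ideal_def by (rule ideal.span_sum)
      moreover have "Poly_Mapping.lookup s e * g_edge e = - (\<Sum>d\<in>F. Poly_Mapping.lookup s d * g_edge d)"
        using insert.prems(2) insert.hyps unfolding first_syzygy_def LSS_map_def eq_neg_iff_add_eq_0 by simp
      ultimately have "Poly_Mapping.lookup s e * g_poly u v \<in> ?I"
        using e by simp
      moreover have "\<chi> u \<noteq> \<chi> v" using \<chi>[of u v] FE e by blast
      ultimately have "Poly_Mapping.lookup s e * minor \<chi> u v \<in> ?I"
        by (simp add: minor_different_colour)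
      from minor_regular[OF A(1,2) _ _ A(3-5) this] show ?thesis by simp
    qed
    ultimately have "Poly_Mapping.lookup s e \<in> Q" by (rule subsetD)
    then obtain t where t: "t \<in> M" "t \<in> first_syzygy (insert e F)"
      "Poly_Mapping.lookup s e = Poly_Mapping.lookup t e"
      unfolding Q_def by (elim imageE IntE)
    have diff: "s - t \<in> first_syzygy (insert e F)"
      using insert.prems(2) t(2) by (rule free_module.subspace_diff[OF subspace_first_syzygy])
    have "Poly_Mapping.lookup (s - t) e = 0" using t by (simp add: lookup_minus)
    then have "s - t \<in> first_syzygy F"
      using diff insert.hyps by (auto simp: first_syzygy_def free_on_def LSS_map_def in_keys_iff)
    then have "s - t \<in> M" using insert by blast
    then have "(s - t) + t \<in> M" using t(1) M free_module.subspace_add by blast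
    then show ?case by simp
  qed
qed

section \<open>Minimality\<close>

definition monom2 :: "'v \<Rightarrow> 'v \<Rightarrow> ('v \<Rightarrow>\<^sub>0 nat)" where
  "monom2 v w = Poly_Mapping.single v 1 + Poly_Mapping.single w 1"

lemma monom2_dvd_iff:
  "monom2 c d = monom2 a b + m \<longleftrightarrow> (a = c \<and> b = d \<or> a = d \<and> b = c) \<and> m = 0"
proof
  assume eq: "monom2 c d = monom2 a b + m"
  then have lookup: "Poly_Mapping.lookup (monom2 c d) x = Poly_Mapping.lookup (monom2 a b) x + Poly_Mapping.lookup m x" for x
    by (simp add: lookup_add)
  have "a = c \<and> b = d \<or> a = d \<and> b = c"
    using lookup[of a] lookup[of b] by (auto simp: monom2_def lookup_add lookup_single when_def split: if_splits)
  then show "(a = c \<and> b = d \<or> a = d \<and> b = c) \<and> m = 0"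
    using eq by (auto simp: monom2_def add.commute)
qed (auto simp: monom2_def add.commute)

lemma g_poly_conv_monom2:
  "g_poly i j = Poly_Mapping.single (monom2 (XVar i) (XVar j)) 1 + Poly_Mapping.single (monom2 (YVar i) (YVar j)) 1"
  by (simp add: g_poly_def Var_def mult_single monom2_def)

lemma f_poly_conv_monom2:
  "f_poly i j = Poly_Mapping.single (monom2 (XVar i) (YVar j)) 1 - Poly_Mapping.single (monom2 (XVar j) (YVar i)) 1"
  by (simp add: f_poly_def Var_def mult_single monom2_def)

text \<open>All divisors of \<open>\<mu>\<close> are excluded, and not only \<open>\<mu>\<close>, to
  obtain a set closed under multiplication by arbitrary polynomials.\<close>

definition divisor_free :: "'m::comm_monoid_add \<Rightarrow> ('m \<Rightarrow>\<^sub>0 'k::comm_ring_1) set" where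
  "divisor_free \<mu> = {p. \<forall>m m'. \<mu> = m + m' \<longrightarrow> Poly_Mapping.lookup p m = 0}"

text \<open>A term of \<open>q * p\<close> is a multiple of a term of \<open>p\<close>; if the
  product divides \<open>\<mu>\<close>, so does that term of \<open>p\<close>.\<close>

lemma subspace_divisor_free: "ideal.subspace (divisor_free \<mu>)"
proof (rule ideal.subspaceI)
  fix q p :: "'a \<Rightarrow>\<^sub>0 'b" assume p: "p \<in> divisor_free \<mu>"
  have "Poly_Mapping.lookup (q * p) m = 0" if "\<mu> = m + m'" for m m'
  proof (rule ccontr)
    assume "Poly_Mapping.lookup (q * p) m \<noteq> 0"
    then have "m \<in> Poly_Mapping.keys (q * p)" by (simp add: in_keys_iff)
    then obtain a b where "b \<in> Poly_Mapping.keys p" "m = a + b" using keys_mult by blast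
    moreover from this that have "\<mu> = b + (a + m')" by (simp add: ac_simps)
    ultimately show False using p unfolding divisor_free_def in_keys_iff by blast
  qed
  then show "q * p \<in> divisor_free \<mu>" unfolding divisor_free_def by blast
qed (auto simp: divisor_free_def lookup_add)

lemma monom2_mem_divisor_free:
  "\<not> (a = c \<and> b = d \<or> a = d \<and> b = c) \<Longrightarrow> Poly_Mapping.single (monom2 a b) x \<in> divisor_free (monom2 c d)"
  by (auto simp: divisor_free_def lookup_single when_def monom2_dvd_iff)

lemma g_poly_mem_divisor_free:
  "g_poly i j \<in> divisor_free (monom2 (XVar a) (YVar b))"
  "{i, j} \<noteq> {a, b} \<Longrightarrow> g_poly i j \<in> divisor_free (monom2 (XVar a) (XVar b))"
  unfolding g_poly_conv_monom2
  by (intro ideal.subspace_add[OF subspace_divisor_free] monom2_mem_divisor_free; auto)+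

lemma f_poly_mem_divisor_free:
  "(i, j) \<noteq> (a, b) \<Longrightarrow> (j, i) \<noteq> (a, b) \<Longrightarrow> f_poly i j \<in> divisor_free (monom2 (XVar a) (YVar b))"
  "f_poly i j \<in> divisor_free (monom2 (XVar a) (XVar b))"
  unfolding f_poly_conv_monom2
  by (intro ideal.subspace_diff[OF subspace_divisor_free] monom2_mem_divisor_free; auto)+

lemma monom2_eq_iff: "monom2 a b = monom2 c d \<longleftrightarrow> a = c \<and> b = d \<or> a = d \<and> b = c"
  using monom2_dvd_iff[of a b c d 0] by auto

lemma g_poly_not_mem_divisor_free: "g_poly i j \<notin> divisor_free (monom2 (XVar i) (XVar j))"
  unfolding divisor_free_def g_poly_conv_monom2
  by (auto simp: lookup_add lookup_single when_def monom2_eq_iff intro!: exI[of _ "monom2 (XVar i) (XVar j)"])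

lemma f_poly_not_mem_divisor_free: "i \<noteq> j \<Longrightarrow> f_poly i j \<notin> divisor_free (monom2 (XVar i) (YVar j))"
  unfolding divisor_free_def f_poly_conv_monom2
  by (auto simp: lookup_minus lookup_single when_def monom2_eq_iff intro!: exI[of _ "monom2 (XVar i) (YVar j)"])

text \<open>Vectors whose component at \<open>b\<close> lies in the ideal
  \<open>divisor_free \<mu>\<close> form a submodule. It contains every other generator but not
  \<open>v i\<close>, so \<open>v i\<close> cannot be omitted.\<close>

lemma minimally_generatesI:
  assumes span: "free_module.span (v ` I) = M"
    and separated: "\<And>i. i \<in> I \<Longrightarrow> \<exists>b \<mu>. Poly_Mapping.lookup (v i) b \<notin> divisor_free \<mu> \<and>
      (\<forall>j\<in>I. j \<noteq> i \<longrightarrow> Poly_Mapping.lookup (v j) b \<in> divisor_free \<mu>)"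
  shows "minimally_generates I v M"
  unfolding minimally_generates_def
proof (intro conjI allI impI)
  fix J assume "J \<subset> I"
  then obtain i where i: "i \<in> I" "i \<notin> J" by blast
  from separated[OF i(1)] obtain b \<mu> where b: "Poly_Mapping.lookup (v i) b \<notin> divisor_free \<mu>"
    "\<And>j. j \<in> I \<Longrightarrow> j \<noteq> i \<Longrightarrow> Poly_Mapping.lookup (v j) b \<in> divisor_free \<mu>" by blast
  let ?W = "{w. Poly_Mapping.lookup w b \<in> divisor_free \<mu>}"
  have "free_module.subspace ?W"
    using ideal.subspace_0[OF subspace_divisor_free, of \<mu>]
    by (intro free_module.subspaceI)
      (simp_all add: lookup_add ideal.subspace_add[OF subspace_divisor_free]
        ideal.subspace_scale[OF subspace_divisor_free])
  moreover have "v ` J \<subseteq> ?W" using b(2) i \<open>J \<subset> I\<close> by blast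
  ultimately have "free_module.span (v ` J) \<subseteq> ?W" by (intro free_module.span_minimal)
  moreover have "v i \<in> M" using i(1) span by (auto intro: free_module.span_base)
  ultimately show "free_module.span (v ` J) \<noteq> M" using b(1) by blast
qed (rule span)

lemma lookup_koszul_syz:
  "Poly_Mapping.lookup (koszul_syz (d, e)) c = (if e = c then g_edge d else 0) - (if d = c then g_edge e else 0)"
  by (simp add: koszul_syz_def lookup_minus basis_vec_def lookup_single when_def)

lemma lookup_claw_syz:
  "Poly_Mapping.lookup (claw_syz (i, j, k, l)) c = (if {i, j} = c then f_poly k l else 0)
     - (if {i, k} = c then f_poly j l else 0) + (if {i, l} = c then f_poly j k else 0)"
  by (simp add: claw_syz_def lookup_minus lookup_add basis_vec_def lookup_single when_def)

lemma induced_clawsD: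
  assumes "(i, j, k, l) \<in> induced_claws E"
  shows "{i, j} \<in> E" "{i, k} \<in> E" "{i, l} \<in> E" "j < k" "k < l" "i \<notin> {j, k, l}"
proof -
  have "{e \<in> E. e \<subseteq> {i, j, k, l}} = {{i, j}, {i, k}, {i, l}}"
    and *: "j < k" "k < l" "i \<notin> {j, k, l}"
    using assms by (simp_all add: induced_claws_def)
  then show "{i, j} \<in> E" "{i, k} \<in> E" "{i, l} \<in> E" by blast+
  show "j < k" "k < l" "i \<notin> {j, k, l}" using * .
qed

text \<open>Any three edges at a vertex of a tree form an induced claw, as an edge between two
  leaves would close a triangle.\<close>

lemma tree_induced_clawsI:
  assumes tree: "tree E" and edges: "{i, j} \<in> E" "{i, k} \<in> E" "{i, l} \<in> E" and "j < k" "k < l"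
  shows "(i, j, k, l) \<in> induced_claws E"
proof -
  have ne: "i \<noteq> j" "i \<noteq> k" "i \<noteq> l" using tree_edge_ne[OF tree] edges by metis+
  have no: "{j, k} \<notin> E" "{j, l} \<notin> E" "{k, l} \<notin> E"
    using tree_no_triangle[OF tree edges(1,2)] tree_no_triangle[OF tree edges(1,3)]
      tree_no_triangle[OF tree edges(2,3)] assms(5,6) by auto
  have "{e \<in> E. e \<subseteq> {i, j, k, l}} \<subseteq> {{i, j}, {i, k}, {i, l}}"
  proof
    fix e assume "e \<in> {e \<in> E. e \<subseteq> {i, j, k, l}}"
    then have e: "e \<in> E" "e \<subseteq> {i, j, k, l}" by auto
    from e(1) obtain a b where ab: "e = {a, b}" "a \<noteq> b" by (rule tree_edge_cases[OF tree])
    with e(2) have "a \<in> {i, j, k, l}" "b \<in> {i, j, k, l}" by auto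
    then show "e \<in> {{i, j}, {i, k}, {i, l}}"
      using ab no e(1) by (auto simp: insert_commute)
  qed
  then show ?thesis using assms ne by (auto simp: induced_claws_def)
qed

theorem theorem5p2:
  fixes E :: "'n::{finite, linorder} set set"
    and P :: "('n set \<times> 'n set) set"
  assumes "tree E"
    and "one_order_per_pair E P"
  shows "minimally_generates (P <+> induced_claws E) (case_sum koszul_syz claw_syz)
           (first_syzygy E :: ('n set \<Rightarrow>\<^sub>0 ('n, 'k::field) S) set)"
proof (rule minimally_generatesI)
  let ?I = "P <+> induced_claws E"
  let ?v = "case_sum koszul_syz claw_syz :: _ \<Rightarrow> ('n set \<Rightarrow>\<^sub>0 ('n, 'k) S)"
  let ?M = "free_module.span (?v ` ?I)"
  have P: "P \<subseteq> E \<times> E" "irrefl P" "\<And>d e. d \<in> E \<Longrightarrow> e \<in> E \<Longrightarrow> d \<noteq> e \<Longrightarrow> (d, e) \<in> P \<longleftrightarrow> (e, d) \<notin> P"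
    using assms(2) unfolding one_order_per_pair_def by (blast+)
  have koszul_base: "koszul_syz p \<in> ?M" if "p \<in> P" for p
    using that free_module.span_base[OF imageI[of "Inl p" ?I ?v]] by (simp add: InlI)
  have claw_base: "claw_syz c \<in> ?M" if "c \<in> induced_claws E" for c
    using that free_module.span_base[OF imageI[of "Inr c" ?I ?v]] by (simp add: InrI)
  show "?M = first_syzygy E"
  proof
    have "?v x \<in> first_syzygy E" if x: "x \<in> ?I" for x
    proof (cases x)
      case (Inl p)
      then show ?thesis using x P(1) by (cases p) (auto intro: koszul_syz_mem)
    next
      case (Inr c)
      obtain i j k l where "c = (i, j, k, l)" by (cases c)
      then show ?thesis using x Inr by (auto intro: claw_syz_mem dest: induced_clawsD)
    qed
    then show "?M \<subseteq> first_syzygy E"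
      by (intro free_module.span_minimal subspace_first_syzygy) blast
    have koszul: "koszul_syz (d, e) \<in> ?M" if "d \<in> E" "e \<in> E" "d \<noteq> e" for d e
    proof (cases "(d, e) \<in> P")
      case True
      then show ?thesis by (rule koszul_base)
    next
      case False
      then have "(e, d) \<in> P" using P(3) that by blast
      then show ?thesis
        using koszul_base free_module.span_neg koszul_syz_swap[of d e] by metis
    qed
    have sorted: "claw_syz (i, j, k, l) \<in> ?M"
      if "{i, j} \<in> E" "{i, k} \<in> E" "{i, l} \<in> E" "j < k" "k < l" for i j k l
      using tree_induced_clawsI[OF assms(1) that] by (rule claw_base)
    have neg: "- x \<in> ?M \<longleftrightarrow> x \<in> ?M" for x
      using free_module.span_neg[of x] free_module.span_neg[of "- x"] by auto
    have swap: "claw_syz (i, k, j, l) \<in> ?M \<longleftrightarrow> claw_syz (i, j, k, l) \<in> ?M"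
      "claw_syz (i, j, l, k) \<in> ?M \<longleftrightarrow> claw_syz (i, j, k, l) \<in> ?M" for i j k l
      by (metis claw_syz_swap(1) neg, metis claw_syz_swap(2) neg)
    have claw: "claw_syz (i, j, k, l) \<in> ?M"
      if e: "{i, j} \<in> E" "{i, k} \<in> E" "{i, l} \<in> E" and dist: "distinct [j, k, l]" for i j k l
    proof -
      \<comment> \<open>Transpositions change only the sign of the claw syzygy, so each of the six
        orders reduces to the sorted one.\<close>
      consider "j < k" "k < l" | "j < l" "l < k" | "k < j" "j < l" | "k < l" "l < j" | "l < j" "j < k" | "l < k" "k < j"
        using dist by fastforce
      then show ?thesis
        using sorted[OF e(1,2,3)] sorted[OF e(1,3,2)] sorted[OF e(2,1,3)] sorted[OF e(2,3,1)]
          sorted[OF e(3,1,2)] sorted[OF e(3,2,1)] swap by cases metis+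
    qed
    show "first_syzygy E \<subseteq> ?M"
      using syzygy_mem_generated[OF assms(1) free_module.subspace_span koszul claw] by blast
  qed
  fix x assume x: "x \<in> ?I"
  note free = ideal.subspace_0[OF subspace_divisor_free] ideal.subspace_add[OF subspace_divisor_free]
    ideal.subspace_diff[OF subspace_divisor_free]
  show "\<exists>c \<mu>. Poly_Mapping.lookup (?v x) c \<notin> divisor_free \<mu> \<and>
      (\<forall>y\<in>?I. y \<noteq> x \<longrightarrow> Poly_Mapping.lookup (?v y) c \<in> divisor_free \<mu>)"
  proof (cases x)
    case (Inl p)
    then obtain d e where de: "p = (d, e)" "(d, e) \<in> P" using x by (cases p) auto
    then have "d \<in> E" "e \<in> E" "d \<noteq> e" using P(1,2) by (auto simp: irrefl_def)
    then have "(e, d) \<notin> P" using P(3) de(2) by blast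
    obtain a b where d: "d = {a, b}" using \<open>d \<in> E\<close> by (rule tree_edge_cases[OF assms(1)])
    \<comment> \<open>At \<open>e\<close> the Koszul syzygy has the component
      \<open>g_edge d\<close>, which contains this monomial. Claw components have only mixed terms,
      and other Koszul syzygies show up to sign another edge polynomial or 0 there, the reversed
      pair being absent from \<open>P\<close>.\<close>
    let ?F = "divisor_free (monom2 (XVar a) (XVar b)) :: ('n, 'k) S set"
    have g: "g_edge d' \<in> ?F" if "d' \<in> E" "d' \<noteq> d" for d'
    proof -
      obtain a' b' where "d' = {a', b'}" using \<open>d' \<in> E\<close> by (rule tree_edge_cases[OF assms(1)])
      then show ?thesis using that(2) d by (simp add: g_poly_mem_divisor_free)
    qed
    show ?thesis
    proof (intro exI conjI ballI impI)
      show "Poly_Mapping.lookup (?v x) e \<notin> ?F"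
        using Inl de(1) d \<open>d \<noteq> e\<close> by (simp add: lookup_koszul_syz g_poly_not_mem_divisor_free)
      fix y assume y: "y \<in> ?I" "y \<noteq> x"
      show "Poly_Mapping.lookup (?v y) e \<in> ?F"
      proof (cases y)
        case (Inl q)
        obtain d' e' where q: "q = (d', e')" by (cases q)
        then have "(d', e') \<in> P" "(d', e') \<noteq> (d, e)" using y Inl \<open>x = Inl p\<close> de(1) by auto
        then have "g_edge d' \<in> ?F" if "e' = e" using that P(1) g by blast
        moreover have "g_edge e' \<in> ?F" if "d' = e"
          using that \<open>(d', e') \<in> P\<close> P(1) \<open>(e, d) \<notin> P\<close> g by blast
        ultimately show ?thesis
          using Inl q by (simp only: sum.case lookup_koszul_syz, intro free(3)) (simp_all add: free(1))
      next
        case (Inr c)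
        obtain i j k l where "c = (i, j, k, l)" by (cases c)
        with Inr show ?thesis
          by (simp only: sum.case lookup_claw_syz, intro free(2,3))
            (simp_all add: f_poly_mem_divisor_free free(1))
      qed
    qed
  next
    case (Inr c)
    then obtain i j k l where c: "c = (i, j, k, l)" "(i, j, k, l) \<in> induced_claws E"
      using x by (cases c) auto
    note claw = induced_clawsD[OF c(2)]
    \<comment> \<open>Excludes claws with center \<open>j\<close> and leaf \<open>k\<close>, which
      could share the edge \<open>{i, j}\<close>.\<close>
    have jk: "{j, k} \<notin> E" using tree_no_triangle[OF assms(1) claw(1,2)] claw(4) by simp
    \<comment> \<open>A term of \<open>f_poly k l\<close>, the component at \<open>{i, j}\<close>.
      Edge polynomials have no mixed terms. Another claw with this term there would have center
      \<open>i\<close> and the same leaves, against the fixed leaf order, or center \<open>j\<close>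
      and leaf \<open>k\<close>.\<close>
    let ?F = "divisor_free (monom2 (XVar k) (YVar l)) :: ('n, 'k) S set"
    show ?thesis
    proof (intro exI conjI ballI impI)
      have "{i, k} \<noteq> {i, j}" "{i, l} \<noteq> {i, j}" "k \<noteq> l" using claw by (auto simp: doubleton_eq_iff)
      then show "Poly_Mapping.lookup (?v x) {i, j} \<notin> ?F"
        using Inr c(1) by (simp add: lookup_claw_syz f_poly_not_mem_divisor_free)
      fix y assume y: "y \<in> ?I" "y \<noteq> x"
      show "Poly_Mapping.lookup (?v y) {i, j} \<in> ?F"
      proof (cases y)
        case (Inl q)
        obtain d e where "q = (d, e)" by (cases q)
        with Inl show ?thesis
          by (simp only: sum.case lookup_koszul_syz, intro free(3))
            (simp_all add: g_edge_def g_poly_mem_divisor_free free(1))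
      next
        case (Inr c')
        obtain i' j' k' l' where c': "c' = (i', j', k', l')" by (cases c')
        then have mem: "(i', j', k', l') \<in> induced_claws E" and ne: "(i', j', k', l') \<noteq> (i, j, k, l)"
          using y Inr \<open>x = Inr c\<close> c(1) by auto
        note claw' = induced_clawsD[OF mem]
        have "f_poly k' l' \<in> ?F" if "{i', j'} = {i, j}"
          using that ne claw' claw jk by (intro f_poly_mem_divisor_free) (auto simp: doubleton_eq_iff)
        moreover have "f_poly j' l' \<in> ?F" if "{i', k'} = {i, j}"
          using that claw' claw jk by (intro f_poly_mem_divisor_free) (auto simp: doubleton_eq_iff)
        moreover have "f_poly j' k' \<in> ?F" if "{i', l'} = {i, j}"
          using that claw' claw jk by (intro f_poly_mem_divisor_free) (auto simp: doubleton_eq_iff)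
        ultimately show ?thesis
          using Inr c' by (simp only: sum.case lookup_claw_syz, intro free(2,3)) (simp_all add: free(1))
      qed
    qed
  qed
qed

end
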